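(* Let $E$ be a punctual equivalence structure which is relatively $\Delta^0_1$-categorical and not punctually categorical. Then $\mathrm{PrCat}(E)=\mathrm{Cone}(\Delta^0_1)$.
   Context: An equivalence structure is a set with one equivalence relation. A structure is punctual if its domain is $\omega$ and its relations and functions are uniformly primitive recursive. A structure is punctually categorical if any two punctual structures isomorphic to it are isomorphic via a primitive recursive bijection whose inverse is also primitive recursive. A computable structure $A$ is relatively $\Delta^0_\alpha$-categorical if for every copy $B\cong A$ with domain $\omega$ there is an isomorphism $f:B\to A$ with $f\in\Delta^0_\alpha$ relative to the atomic diagram of $B$ (for $\alpha=1$ this is relative computable categoricity). For total $f,g:\omega\to\omega$, write $f\le_{PR}g$ if $f$ is primitive recursive relative to $g$ (i.e. $f=\Psi^g$ for some primitive recursive scheme $\Psi$); the induced equivalence classes are PR-degrees, and $f\le_{PR}\mathbf d$ means $f\le_{PR}$ a member of $\mathbf d$. For a punctual structure $A$, $\mathrm{PrCat}(A)$ is the set of PR-degrees $\mathbf d$ such that for every punctual $B\cong A$ there is an isomorphism $f:A\to B$ with $f\le_{PR}\mathbf d$ and $f^{-1}\le_{PR}\mathbf d$. For a computable ordinal $\alpha>0$, $\mathrm{Cone}(\Delta^0_\alpha)$ is the set of PR-degrees $\mathbf d$ such that $f\le_{PR}\mathbf d$ for every total $\Delta^0_\alpha$ function $f:\omega\to\omega$. *)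

theory Defs
  imports Main "HOL-Library.Nat_Bijection"
begin

datatype scheme =
    Zero
  | Succ
  | Proj nat
  | Oracle
  | Comp scheme "scheme list"
  | PrimRec scheme scheme
  | Mu scheme

text \<open>
  Arities are implicit: the arity is the length of the argument list. \<^const>\<open>Zero\<close> has every
  arity, and the other basic functions have no value at a list of unsuitable length.
  Projections count from 0, recursion and minimisation act on the first argument, and
  minimisation requires convergence at all smaller arguments.
\<close>

inductive eval :: "(nat \<Rightarrow> nat) \<Rightarrow> scheme \<Rightarrow> nat list \<Rightarrow> nat \<Rightarrow> bool"
  for g :: "nat \<Rightarrow> nat"
where
  Zero: "eval g Zero xs 0"
| Succ: "eval g Succ [x] (Suc x)"
| Proj: "i < length xs \<Longrightarrow> eval g (Proj i) xs (xs ! i)"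
| Oracle: "eval g Oracle [x] (g x)"
| Comp: "list_all2 (\<lambda>q y. eval g q xs y) qs ys \<Longrightarrow> eval g p ys z \<Longrightarrow> eval g (Comp p qs) xs z"
| PrimRec_0: "eval g p xs y \<Longrightarrow> eval g (PrimRec p q) (0 # xs) y"
| PrimRec_Suc: "eval g (PrimRec p q) (n # xs) y \<Longrightarrow> eval g q (n # y # xs) z
    \<Longrightarrow> eval g (PrimRec p q) (Suc n # xs) z"
| Mu: "eval g p (n # xs) 0 \<Longrightarrow> (\<forall>m<n. \<exists>k. eval g p (m # xs) (Suc k)) \<Longrightarrow> eval g (Mu p) xs n"

fun primitive_scheme :: "scheme \<Rightarrow> bool" where
  "primitive_scheme (Comp p qs) = (primitive_scheme p \<and> (\<forall>q\<in>set qs. primitive_scheme q))"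
| "primitive_scheme (PrimRec p q) = (primitive_scheme p \<and> primitive_scheme q)"
| "primitive_scheme (Mu p) = False"
| "primitive_scheme _ = True"

text \<open>
  Total functions and relations of arity \<open>n\<close> are functions on argument lists, of which only the
  values at lists of length \<open>n\<close> matter.
\<close>

definition primrec_in :: "(nat \<Rightarrow> nat) \<Rightarrow> nat \<Rightarrow> (nat list \<Rightarrow> nat) \<Rightarrow> bool" where
  "primrec_in g n F \<longleftrightarrow>
     (\<exists>s. primitive_scheme s \<and> (\<forall>xs. length xs = n \<longrightarrow> eval g s xs (F xs)))"

definition computable_in :: "(nat \<Rightarrow> nat) \<Rightarrow> nat \<Rightarrow> (nat list \<Rightarrow> nat) \<Rightarrow> bool" where
  "computable_in g n F \<longleftrightarrow> (\<exists>s. \<forall>xs. length xs = n \<longrightarrow> eval g s xs (F xs))"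

text \<open>
  Unrelativised notions use this oracle. It adds nothing, being itself a basic function.
\<close>

abbreviation no_oracle :: "nat \<Rightarrow> nat" where
  "no_oracle \<equiv> (\<lambda>_. 0)"

definition primrec_fun :: "(nat \<Rightarrow> nat) \<Rightarrow> bool" where
  "primrec_fun f \<longleftrightarrow> primrec_in no_oracle 1 (\<lambda>xs. f (xs ! 0))"

definition Sigma01_in :: "(nat \<Rightarrow> nat) \<Rightarrow> nat \<Rightarrow> (nat list \<Rightarrow> bool) \<Rightarrow> bool" where
  "Sigma01_in g n R \<longleftrightarrow>
     (\<exists>S. computable_in g (Suc n) (\<lambda>xs. of_bool (S xs)) \<and>
          (\<forall>xs. length xs = n \<longrightarrow> (R xs \<longleftrightarrow> (\<exists>z. S (z # xs)))))"

definition Pi01_in :: "(nat \<Rightarrow> nat) \<Rightarrow> nat \<Rightarrow> (nat list \<Rightarrow> bool) \<Rightarrow> bool" where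
  "Pi01_in g n R \<longleftrightarrow> Sigma01_in g n (\<lambda>xs. \<not> R xs)"

definition Delta01_in :: "(nat \<Rightarrow> nat) \<Rightarrow> nat \<Rightarrow> (nat list \<Rightarrow> bool) \<Rightarrow> bool" where
  "Delta01_in g n R \<longleftrightarrow> Sigma01_in g n R \<and> Pi01_in g n R"

definition Delta01_fun_in :: "(nat \<Rightarrow> nat) \<Rightarrow> (nat \<Rightarrow> nat) \<Rightarrow> bool" where
  "Delta01_fun_in g f \<longleftrightarrow> Delta01_in g 2 (\<lambda>xs. f (xs ! 0) = xs ! 1)"

definition PR_le :: "(nat \<Rightarrow> nat) \<Rightarrow> (nat \<Rightarrow> nat) \<Rightarrow> bool"  (infix "\<le>\<^sub>P\<^sub>R" 50) where
  "f \<le>\<^sub>P\<^sub>R g \<longleftrightarrow> primrec_in g 1 (\<lambda>xs. f (xs ! 0))"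

definition PR_equiv :: "(nat \<Rightarrow> nat) rel" where
  "PR_equiv = {(f, g). f \<le>\<^sub>P\<^sub>R g \<and> g \<le>\<^sub>P\<^sub>R f}"

definition PR_degrees :: "(nat \<Rightarrow> nat) set set" where
  "PR_degrees = UNIV // PR_equiv"

definition PR_le_degree :: "(nat \<Rightarrow> nat) \<Rightarrow> (nat \<Rightarrow> nat) set \<Rightarrow> bool"  (infix "\<preceq>\<^sub>P\<^sub>R" 50) where
  "f \<preceq>\<^sub>P\<^sub>R d \<longleftrightarrow> (\<exists>g\<in>d. f \<le>\<^sub>P\<^sub>R g)"

definition isomorphism :: "nat rel \<Rightarrow> nat rel \<Rightarrow> (nat \<Rightarrow> nat) \<Rightarrow> bool" where
  "isomorphism A B f \<longleftrightarrow> bij f \<and> (\<forall>x y. (x, y) \<in> A \<longleftrightarrow> (f x, f y) \<in> B)"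

definition isomorphic :: "nat rel \<Rightarrow> nat rel \<Rightarrow> bool" where
  "isomorphic A B \<longleftrightarrow> (\<exists>f. isomorphism A B f)"

definition punctual :: "nat rel \<Rightarrow> bool" where
  "punctual A \<longleftrightarrow> primrec_in no_oracle 2 (\<lambda>xs. of_bool ((xs ! 0, xs ! 1) \<in> A))"

definition punctually_categorical :: "nat rel \<Rightarrow> bool" where
  "punctually_categorical A \<longleftrightarrow>
     (\<forall>B C. punctual B \<and> isomorphic B A \<and> punctual C \<and> isomorphic C A \<longrightarrow>
       (\<exists>f. isomorphism B C f \<and> primrec_fun f \<and> primrec_fun (inv f)))"

text \<open>
  The atomic diagram as an oracle, with pairs coded by \<^const>\<open>prod_encode\<close>. The equalities
  and inequalities between elements of \<open>\<omega>\<close> carry no information and are left out.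
\<close>

definition atomic_diagram :: "nat rel \<Rightarrow> nat \<Rightarrow> nat" where
  "atomic_diagram B n = of_bool (prod_decode n \<in> B)"

definition rel_Delta01_categorical :: "nat rel \<Rightarrow> bool" where
  "rel_Delta01_categorical A \<longleftrightarrow>
     (\<forall>B. isomorphic B A \<longrightarrow>
       (\<exists>f. isomorphism B A f \<and> Delta01_fun_in (atomic_diagram B) f))"

definition PrCat :: "nat rel \<Rightarrow> (nat \<Rightarrow> nat) set set" where
  "PrCat A = {d \<in> PR_degrees. \<forall>B. punctual B \<and> isomorphic B A \<longrightarrow>
     (\<exists>f. isomorphism A B f \<and> f \<preceq>\<^sub>P\<^sub>R d \<and> inv f \<preceq>\<^sub>P\<^sub>R d)}"

definition Cone_Delta01 :: "(nat \<Rightarrow> nat) set set" where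
  "Cone_Delta01 = {d \<in> PR_degrees. \<forall>f. Delta01_fun_in no_oracle f \<longrightarrow> f \<preceq>\<^sub>P\<^sub>R d}"

end

theory Submission
  imports Defs "HOL-Library.Countable" "HOL-Library.Equipollence"
begin

text \<open>
  If the degree bounds all computable functions, it bounds the isomorphisms provided by relative
  categoricity, which are computable because the atomic diagram of a punctual copy is primitive
  recursive.

  For the converse, every computable \<open>f\<close> has a nondecreasing time function \<open>t\<close> with primitive
  recursive graph, and \<open>f\<close> is primitive recursive in every bound on \<open>t\<close>. Isomorphisms between any
  two punctual copies of \<open>E\<close> are available below the degree, so it suffices to exhibit a fast and a
  slow copy such that every isomorphism between them, together with its inverse, yields a bound on
  \<open>t\<close>. A finite extension argument shows that, by relative categoricity, either finitely many
  classes are finite or all but finitely many classes have the same finite size \<open>k\<close>. If there are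
  finitely many exceptional points outside of which all points look alike, then \<open>E\<close> is punctually
  categorical, because isomorphisms can be chosen to be the identity almost everywhere. In the
  remaining cases a slow copy fills the time with members of an infinite class, while the members of
  all other classes are late, or, if all classes are finite, with first members of new classes,
  while the further members are late.
\<close>

section \<open>Primitive recursive functions\<close>

text \<open>An isomorphism below \<open>g\<close> is arbitrary: it may permute classes of equal size
  at will. So only coarse data is exploited, namely that among the images of few early points of the
  fast copy there is a position at or beyond \<open>t n\<close>. If an infinite class is the filler,
  points avoiding it must go to late positions. Which class of the fast copy corresponds to the
  filler is unknown, but it is one number and may be hard-coded; pigeonhole and monotonicity of
  \<open>t\<close> do the rest. If all classes are finite, every class has an early member and
  avoidance does not help. Instead an early filler is pulled back by the inverse, its class is close
  by in the fast copy, and the images of that window include a late classmate. Late positions are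
  built from codes of \<open>(n, t n)\<close>: they are recognised from the graph of
  \<open>t\<close> even when \<open>t\<close> grows too fast to be primitive recursive. In the
  diagonalisation a class with finitely many listed members can still be made larger, but not
  smaller. It therefore needs small finite classes for which larger ones remain available outside
  every finite set; its failure yields the dichotomy of class sizes.\<close>

lemma primrec_in_cong:
  assumes "primrec_in g n F" and "\<And>xs. length xs = n \<Longrightarrow> F xs = G xs"
  shows "primrec_in g n G"
  using assms unfolding primrec_in_def by metis

lemma pr_zero: "primrec_in g n (\<lambda>_. 0)"
  unfolding primrec_in_def by (intro exI[of _ Zero]) (simp add: eval.Zero)

lemma pr_nth: "i < n \<Longrightarrow> primrec_in g n (\<lambda>xs. xs ! i)"
  unfolding primrec_in_def by (intro exI[of _ "Proj i"]) (simp add: eval.Proj)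

lemma pr_comp:
  assumes P: "primrec_in g (length Qs) P" and Q: "\<And>Q. Q \<in> set Qs \<Longrightarrow> primrec_in g n Q"
  shows "primrec_in g n (\<lambda>xs. P (map (\<lambda>Q. Q xs) Qs))"
proof -
  obtain s where s: "primitive_scheme s" "\<And>xs. length xs = length Qs \<Longrightarrow> eval g s xs (P xs)"
    using P unfolding primrec_in_def by blast
  have "\<forall>Q\<in>set Qs. \<exists>r. primitive_scheme r \<and> (\<forall>xs. length xs = n \<longrightarrow> eval g r xs (Q xs))"
    using Q unfolding primrec_in_def by blast
  then obtain r where r: "\<And>Q. Q \<in> set Qs \<Longrightarrow> primitive_scheme (r Q)"
    "\<And>Q xs. Q \<in> set Qs \<Longrightarrow> length xs = n \<Longrightarrow> eval g (r Q) xs (Q xs)"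
    by metis
  have "eval g (Comp s (map r Qs)) xs (P (map (\<lambda>Q. Q xs) Qs))" if "length xs = n" for xs
  proof (rule eval.Comp)
    show "list_all2 (\<lambda>q y. eval g q xs y) (map r Qs) (map (\<lambda>Q. Q xs) Qs)"
      using r(2) that by (simp add: list_all2_conv_all_nth)
  qed (use s(2) in simp)
  moreover have "primitive_scheme (Comp s (map r Qs))"
    using s(1) r(1) by simp
  ultimately show ?thesis
    unfolding primrec_in_def by blast
qed

lemma pr_comp1:
  assumes "primrec_in g (Suc 0) (\<lambda>xs. f (xs ! 0))" and "primrec_in g n F"
  shows "primrec_in g n (\<lambda>xs. f (F xs))"
  using pr_comp[of g "[F]" "\<lambda>xs. f (xs ! 0)" n] assms by auto

lemma pr_comp2:
  assumes "primrec_in g (Suc (Suc 0)) (\<lambda>xs. f (xs ! 0) (xs ! 1))"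
    and "primrec_in g n F" and "primrec_in g n G"
  shows "primrec_in g n (\<lambda>xs. f (F xs) (G xs))"
  using pr_comp[of g "[F, G]" "\<lambda>xs. f (xs ! 0) (xs ! 1)" n] assms by auto

lemma pr_Suc:
  assumes "primrec_in g n F"
  shows "primrec_in g n (\<lambda>xs. Suc (F xs))"
proof (rule pr_comp1[OF _ assms])
  have "eval g Succ xs (Suc (xs ! 0))" if "length xs = Suc 0" for xs
    using that eval.Succ[of g "xs ! 0"] by (cases xs) auto
  then show "primrec_in g (Suc 0) (\<lambda>xs. Suc (xs ! 0))"
    unfolding primrec_in_def by (intro exI[of _ Succ]) auto
qed

lemma pr_oracle:
  assumes "primrec_in g n F"
  shows "primrec_in g n (\<lambda>xs. g (F xs))"
proof (rule pr_comp1[OF _ assms])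
  have "eval g Oracle xs (g (xs ! 0))" if "length xs = Suc 0" for xs
    using that eval.Oracle[of g "xs ! 0"] by (cases xs) auto
  then show "primrec_in g (Suc 0) (\<lambda>xs. g (xs ! 0))"
    unfolding primrec_in_def by (intro exI[of _ Oracle]) auto
qed

lemma pr_const: "primrec_in g n (\<lambda>_. c)"
  by (induction c) (auto intro: pr_zero pr_Suc)

text \<open>The common source of the substitution rules that follow. Bounded quantifiers, sums and
  recursion put their bound variables in front of the parameters, so bodies see the parameters as
  \<open>drop k xs\<close>; here computed arguments are put in front of such a remainder.\<close>

lemma pr_append_drop:
  assumes P: "primrec_in g (length Qs + m) P"
    and Q: "\<And>Q. Q \<in> set Qs \<Longrightarrow> primrec_in g n Q" and n: "n = k + m"
  shows "primrec_in g n (\<lambda>xs. P (map (\<lambda>Q. Q xs) Qs @ drop k xs))"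
proof (rule primrec_in_cong)
  show "primrec_in g n (\<lambda>xs. P (map (\<lambda>Q. Q xs) (Qs @ map (\<lambda>i xs. xs ! (k + i)) [0..<m])))"
    using assms by (intro pr_comp) (auto intro: pr_nth)
  show "P (map (\<lambda>Q. Q xs) (Qs @ map (\<lambda>i xs. xs ! (k + i)) [0..<m])) =
      P (map (\<lambda>Q. Q xs) Qs @ drop k xs)" if "length xs = n" for xs
    using that n by (intro arg_cong[of _ _ P]) (auto intro!: nth_equalityI simp: comp_def)
qed

lemma pr_drop:
  assumes "primrec_in g n F" and "m = k + n"
  shows "primrec_in g m (\<lambda>xs. F (drop k xs))"
  using pr_append_drop[of g "[]" n F m k] assms by simp

lemma pr_Cons:
  assumes "primrec_in g (Suc n) P" and "primrec_in g n F"
  shows "primrec_in g n (\<lambda>xs. P (F xs # xs))"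
  using pr_append_drop[of g "[F]" n P n 0] assms by simp

lemma pr_Cons_drop:
  assumes "primrec_in g (Suc m) P" and "primrec_in g n A" and "n = k + m"
  shows "primrec_in g n (\<lambda>xs. P (A xs # drop k xs))"
proof -
  have "primrec_in g n (\<lambda>xs. P (map (\<lambda>Q. Q xs) [A] @ drop k xs))"
    by (rule pr_append_drop[where m = m]) (use assms in auto)
  then show ?thesis by simp
qed

lemma pr_Cons2_drop:
  assumes "primrec_in g (Suc (Suc m)) P" and "primrec_in g n A" and "primrec_in g n B"
    and "n = k + m"
  shows "primrec_in g n (\<lambda>xs. P (A xs # B xs # drop k xs))"
proof -
  have "primrec_in g n (\<lambda>xs. P (map (\<lambda>Q. Q xs) [A, B] @ drop k xs))"
    by (rule pr_append_drop[where m = m]) (use assms in auto)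
  then show ?thesis by simp
qed

lemma pr_Cons3_drop:
  assumes "primrec_in g (Suc (Suc (Suc m))) P" and "primrec_in g n A" and "primrec_in g n B"
    and "primrec_in g n C" and "n = k + m"
  shows "primrec_in g n (\<lambda>xs. P (A xs # B xs # C xs # drop k xs))"
proof -
  have "primrec_in g n (\<lambda>xs. P (map (\<lambda>Q. Q xs) [A, B, C] @ drop k xs))"
    by (rule pr_append_drop[where m = m]) (use assms in auto)
  then show ?thesis by simp
qed

lemma pr_drop_nth: "k + i < n \<Longrightarrow> primrec_in g n (\<lambda>xs. drop k xs ! i)"
  by (rule pr_drop[of g "n - k" "\<lambda>xs. xs ! i"]) (auto intro: pr_nth)

text \<open>Nested binders leave iterated \<open>drop\<close>s; this form lets \<open>intro\<close>
  reach the variables of outer binders without simplification.\<close>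

lemma pr_drop_drop_nth: "k + l + i < n \<Longrightarrow> primrec_in g n (\<lambda>xs. drop k (drop l xs) ! i)"
  by (simp add: pr_drop_nth)

lemma pr_drop_drop_drop_nth:
  "k + l + m + i < n \<Longrightarrow> primrec_in g n (\<lambda>xs. drop k (drop l (drop m xs)) ! i)"
  by (simp add: pr_drop_nth)

text \<open>With \<open>rec_nat\<close> in place of \<open>PrimRec\<close>, later recursions need no
  explicit schemes. The step takes the counter at position 0 and the previous value at position 1,
  as \<open>PrimRec\<close> supplies them.\<close>

lemma pr_rec_nat:
  assumes P: "primrec_in g n P"
    and Q: "primrec_in g (Suc (Suc n)) (\<lambda>xs. Q (xs ! 0) (xs ! 1) (drop 2 xs))"
    and F: "primrec_in g n F"
  shows "primrec_in g n (\<lambda>xs. rec_nat (P xs) (\<lambda>i y. Q i y xs) (F xs))"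
proof -
  obtain p where p: "primitive_scheme p" "\<And>xs. length xs = n \<Longrightarrow> eval g p xs (P xs)"
    using P unfolding primrec_in_def by blast
  obtain q where q: "primitive_scheme q"
    "\<And>xs. length xs = Suc (Suc n) \<Longrightarrow> eval g q xs (Q (xs ! 0) (xs ! 1) (drop 2 xs))"
    using Q unfolding primrec_in_def by blast
  have step: "eval g (PrimRec p q) (m # xs) (rec_nat (P xs) (\<lambda>i y. Q i y xs) m)"
    if "length xs = n" for m xs
  proof (induction m)
    case 0
    then show ?case using p(2) that by (auto intro: eval.PrimRec_0)
  next
    case (Suc m)
    let ?y = "rec_nat (P xs) (\<lambda>i y. Q i y xs) m"
    from q(2)[of "m # ?y # xs"] that have "eval g q (m # ?y # xs) (Q m ?y xs)" by simp
    then show ?case using Suc by (auto intro: eval.PrimRec_Suc)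
  qed
  let ?R = "\<lambda>zs. rec_nat (P (tl zs)) (\<lambda>i y. Q i y (tl zs)) (hd zs)"
  have "eval g (PrimRec p q) zs (?R zs)" if "length zs = Suc n" for zs
    using that step[of "tl zs" "hd zs"] by (cases zs) auto
  moreover have "primitive_scheme (PrimRec p q)"
    using p(1) q(1) by simp
  ultimately have "primrec_in g (Suc n) ?R"
    unfolding primrec_in_def by blast
  from pr_Cons[OF this F] show ?thesis by simp
qed

lemma pr_pred:
  assumes "primrec_in g n F"
  shows "primrec_in g n (\<lambda>xs. F xs - 1)"
proof (rule primrec_in_cong)
  show "primrec_in g n (\<lambda>xs. rec_nat 0 (\<lambda>i y. i) (F xs))"
    by (intro pr_rec_nat assms pr_const pr_nth) auto
  show "rec_nat 0 (\<lambda>i y. i) (F xs) = F xs - 1" for xs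
    by (cases "F xs") auto
qed

lemma pr_add:
  assumes "primrec_in g n F" and "primrec_in g n G"
  shows "primrec_in g n (\<lambda>xs. F xs + G xs)"
proof (rule primrec_in_cong)
  show "primrec_in g n (\<lambda>xs. rec_nat (F xs) (\<lambda>i y. Suc y) (G xs))"
    by (intro pr_rec_nat assms pr_Suc pr_nth) auto
  have "rec_nat a (\<lambda>i y. Suc y) b = a + b" for a b :: nat
    by (induction b) auto
  then show "rec_nat (F xs) (\<lambda>i y. Suc y) (G xs) = F xs + G xs" for xs .
qed

lemma pr_diff:
  assumes "primrec_in g n F" and "primrec_in g n G"
  shows "primrec_in g n (\<lambda>xs. F xs - G xs)"
proof (rule primrec_in_cong)
  show "primrec_in g n (\<lambda>xs. rec_nat (F xs) (\<lambda>i y. y - 1) (G xs))"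
    by (intro pr_rec_nat assms pr_pred pr_nth) auto
  have "rec_nat a (\<lambda>i y. y - 1) b = a - b" for a b :: nat
    by (induction b) auto
  then show "rec_nat (F xs) (\<lambda>i y. y - 1) (G xs) = F xs - G xs" for xs .
qed

lemma pr_mult:
  assumes "primrec_in g n F" and "primrec_in g n G"
  shows "primrec_in g n (\<lambda>xs. F xs * G xs)"
proof (rule primrec_in_cong)
  show "primrec_in g n (\<lambda>xs. rec_nat 0 (\<lambda>i y. y + F xs) (G xs))"
    by (intro pr_rec_nat assms pr_add pr_const pr_nth pr_drop[OF assms(1)]) auto
  have "rec_nat 0 (\<lambda>i y. y + a) b = a * b" for a b :: nat
    by (induction b) auto
  then show "rec_nat 0 (\<lambda>i y. y + F xs) (G xs) = F xs * G xs" for xs .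
qed

lemma pr_not:
  "primrec_in g n (\<lambda>xs. of_bool (P xs)) \<Longrightarrow> primrec_in g n (\<lambda>xs. of_bool (\<not> P xs))"
  by (rule primrec_in_cong[OF pr_diff[OF pr_const[of g n 1]]]) auto

lemma pr_conj:
  assumes "primrec_in g n (\<lambda>xs. of_bool (P xs))" and "primrec_in g n (\<lambda>xs. of_bool (Q xs))"
  shows "primrec_in g n (\<lambda>xs. of_bool (P xs \<and> Q xs))"
  by (rule primrec_in_cong[OF pr_mult[OF assms]]) auto

lemma pr_le:
  assumes "primrec_in g n F" and "primrec_in g n G"
  shows "primrec_in g n (\<lambda>xs. of_bool (F xs \<le> G xs))"
  by (rule primrec_in_cong[OF pr_diff[OF pr_const[of g n 1] pr_diff[OF assms]]]) auto

lemma pr_less: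
  assumes "primrec_in g n F" and "primrec_in g n G"
  shows "primrec_in g n (\<lambda>xs. of_bool (F xs < G xs))"
  by (rule primrec_in_cong[OF pr_not[OF pr_le[OF assms(2,1)]]]) auto

lemma pr_eq:
  assumes "primrec_in g n F" and "primrec_in g n G"
  shows "primrec_in g n (\<lambda>xs. of_bool (F xs = G xs))"
  by (rule primrec_in_cong[OF pr_conj[OF pr_le[OF assms] pr_le[OF assms(2,1)]]]) auto

lemma pr_If:
  assumes P: "primrec_in g n (\<lambda>xs. of_bool (P xs))"
    and "primrec_in g n F" and "primrec_in g n G"
  shows "primrec_in g n (\<lambda>xs. if P xs then F xs else G xs)"
  by (rule primrec_in_cong[OF pr_add[OF pr_mult[OF P assms(2)] pr_mult[OF pr_not[OF P] assms(3)]]])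
     auto

lemma pr_sum:
  assumes H: "primrec_in g (Suc n) (\<lambda>xs. H (xs ! 0) (drop 1 xs))" and F: "primrec_in g n F"
  shows "primrec_in g n (\<lambda>xs. \<Sum>i<F xs. H i xs)"
proof (rule primrec_in_cong)
  have "primrec_in g (Suc (Suc n)) (\<lambda>xs. H (xs ! 0) (drop 2 xs))"
  proof -
    have "primrec_in g (Suc (Suc n)) (\<lambda>xs. (\<lambda>zs. H (zs ! 0) (drop 1 zs)) (xs ! 0 # drop 2 xs))"
      by (rule pr_Cons_drop[OF H pr_nth]) auto
    then show ?thesis by simp
  qed
  then show "primrec_in g n (\<lambda>xs. rec_nat 0 (\<lambda>i y. y + H i xs) (F xs))"
    by (intro pr_rec_nat F pr_add pr_const pr_nth) auto
  have "rec_nat 0 (\<lambda>i y. y + H i xs) b = (\<Sum>i<b. H i xs)" for b xs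
    by (induction b) auto
  then show "rec_nat 0 (\<lambda>i y. y + H i xs) (F xs) = (\<Sum>i<F xs. H i xs)" for xs .
qed

lemma pr_bex:
  assumes "primrec_in g (Suc n) (\<lambda>xs. of_bool (P (xs ! 0) (drop 1 xs)))" and "primrec_in g n F"
  shows "primrec_in g n (\<lambda>xs. of_bool (\<exists>i<F xs. P i xs))"
proof (rule primrec_in_cong)
  show "primrec_in g n (\<lambda>xs. of_bool (0 < (\<Sum>i<F xs. of_bool (P i xs) :: nat)))"
    by (intro pr_less pr_sum pr_const assms)
  have "(0 < (\<Sum>i<b. of_bool (P i xs) :: nat)) \<longleftrightarrow> (\<exists>i<b. P i xs)" for b xs
    by (induction b) (auto simp: less_Suc_eq)
  then show "of_bool (0 < (\<Sum>i<F xs. of_bool (P i xs) :: nat)) = (of_bool (\<exists>i<F xs. P i xs) :: nat)"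
    for xs by simp
qed

lemma pr_ball:
  assumes "primrec_in g (Suc n) (\<lambda>xs. of_bool (P (xs ! 0) (drop 1 xs)))" and "primrec_in g n F"
  shows "primrec_in g n (\<lambda>xs. of_bool (\<forall>i<F xs. P i xs))"
  by (rule primrec_in_cong[OF pr_not[OF pr_bex[OF pr_not[OF assms(1)] assms(2)]]]) auto

lemmas pr_intros = pr_const pr_nth pr_drop_nth pr_drop_drop_nth pr_drop_drop_drop_nth pr_Suc pr_add
  pr_diff pr_mult pr_not pr_conj pr_le pr_less pr_eq pr_If pr_sum pr_bex pr_ball

section \<open>Division, pairing and bounded search\<close>

lemma pr_div:
  assumes "primrec_in g n F"
  shows "primrec_in g n (\<lambda>xs. F xs div k)"
proof (cases "k = 0")
  case True
  then show ?thesis by (simp add: pr_const)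
next
  case False
  show ?thesis
  proof (rule primrec_in_cong)
    \<comment> \<open>The quotient is the number of positive multiples of \<open>k\<close> up to
      \<open>F xs\<close>.\<close>
    show "primrec_in g n (\<lambda>xs. \<Sum>i<F xs. of_bool (Suc i * k \<le> F xs))"
      by (intro pr_intros assms pr_drop[OF assms]) auto
    show "(\<Sum>i<F xs. of_bool (Suc i * k \<le> F xs)) = F xs div k" for xs
    proof -
      have "{i. i < F xs \<and> Suc i * k \<le> F xs} = {..<F xs div k}"
      proof (intro set_eqI iffI)
        fix i assume "i \<in> {i. i < F xs \<and> Suc i * k \<le> F xs}"
        then show "i \<in> {..<F xs div k}"
          using False by (simp add: less_eq_div_iff_mult_less_eq flip: Suc_le_eq)
      next
        fix i assume i: "i \<in> {..<F xs div k}"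
        then have "Suc i \<le> F xs"
          by (metis Suc_leI div_le_dividend lessThan_iff less_le_trans)
        with i show "i \<in> {i. i < F xs \<and> Suc i * k \<le> F xs}"
          using False by (simp add: less_eq_div_iff_mult_less_eq flip: Suc_le_eq)
      qed
      then have "card ({..<F xs} \<inter> {i. Suc i * k \<le> F xs}) = F xs div k"
        by (simp add: Int_def)
      then show ?thesis by (simp add: sum.If_cases of_bool_def)
    qed
  qed
qed

lemma pr_mod: "primrec_in g n F \<Longrightarrow> primrec_in g n (\<lambda>xs. F xs mod k)"
  unfolding modulo_nat_def by (intro pr_intros pr_div)

lemma pr_prod_encode:
  "primrec_in g n F \<Longrightarrow> primrec_in g n G \<Longrightarrow> primrec_in g n (\<lambda>xs. prod_encode (F xs, G xs))"
  unfolding prod_encode_def triangle_def by (simp, intro pr_intros pr_div)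

text \<open>Serves as bounded search: when exactly one index satisfies \<open>P\<close>, the sum
  returns its value, so \<open>pr_sum\<close> covers definite descriptions.\<close>

lemma sum_unique:
  fixes h :: "nat \<Rightarrow> nat"
  assumes "a < b" and "\<And>i. i < b \<Longrightarrow> P i \<longleftrightarrow> i = a"
  shows "(\<Sum>i<b. h i * of_bool (P i)) = h a"
proof -
  have "(\<Sum>i<b. h i * of_bool (P i)) = (\<Sum>i<b. if i = a then h i else 0)"
    using assms(2) by (intro sum.cong) auto
  then show ?thesis using assms(1) by simp
qed

text \<open>A pair code is at least both of its components, so decoding is a bounded search.\<close>

lemma pr_fst_decode:
  assumes "primrec_in g n F"
  shows "primrec_in g n (\<lambda>xs. fst (prod_decode (F xs)))"
proof (rule primrec_in_cong)
  show "primrec_in g n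
      (\<lambda>xs. \<Sum>i<Suc (F xs). i * of_bool (\<exists>j<Suc (F xs). prod_encode (i, j) = F xs))"
    by (intro pr_intros pr_prod_encode assms pr_drop[OF assms] pr_drop[OF pr_drop[OF assms refl]])
      simp_all
  fix xs :: "nat list"
  obtain a b where ab: "F xs = prod_encode (a, b)"
    by (metis prod_decode_inverse surj_pair)
  then have "(\<exists>j<Suc (F xs). prod_encode (i, j) = F xs) \<longleftrightarrow> i = a" for i
    using le_prod_encode_2[of b a] by (auto simp: inj_eq[OF inj_prod_encode] less_Suc_eq_le)
  then have "(\<Sum>i<Suc (F xs). i * of_bool (\<exists>j<Suc (F xs). prod_encode (i, j) = F xs)) = a"
    using ab le_prod_encode_1[of a b] by (intro sum_unique) auto
  then show "(\<Sum>i<Suc (F xs). i * of_bool (\<exists>j<Suc (F xs). prod_encode (i, j) = F xs))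
      = fst (prod_decode (F xs))"
    using ab by simp
qed

lemma pr_snd_decode:
  assumes "primrec_in g n F"
  shows "primrec_in g n (\<lambda>xs. snd (prod_decode (F xs)))"
proof (rule primrec_in_cong)
  show "primrec_in g n
      (\<lambda>xs. \<Sum>i<Suc (F xs). i * of_bool (prod_encode (fst (prod_decode (F xs)), i) = F xs))"
    by (intro pr_intros pr_prod_encode pr_fst_decode assms pr_drop[OF assms]) simp_all
  fix xs :: "nat list"
  obtain a b where ab: "F xs = prod_encode (a, b)"
    by (metis prod_decode_inverse surj_pair)
  then have "(\<Sum>i<Suc (F xs). i * of_bool (prod_encode (fst (prod_decode (F xs)), i) = F xs)) = b"
    using le_prod_encode_2[of b a] by (intro sum_unique) (auto simp: inj_eq[OF inj_prod_encode])
  then show "(\<Sum>i<Suc (F xs). i * of_bool (prod_encode (fst (prod_decode (F xs)), i) = F xs))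
      = snd (prod_decode (F xs))"
    using ab by simp
qed

text \<open>\<open>w\<close> is arbitrary: its finitely many relevant values are hard-wired one case
  distinction at a time. This makes finite noncomputable choices harmless later on.\<close>

lemma pr_finite_modification:
  assumes "primrec_in g (Suc 0) (\<lambda>xs. c (xs ! 0))"
  shows "primrec_in g (Suc 0) (\<lambda>xs. if xs ! 0 < N then w (xs ! 0) else c (xs ! 0))"
proof (induction N)
  case 0
  then show ?case using assms by simp
next
  case (Suc N)
  have "primrec_in g (Suc 0)
     (\<lambda>xs. if xs ! 0 = N then w N else if xs ! 0 < N then w (xs ! 0) else c (xs ! 0))"
    by (intro pr_If[OF _ _ Suc] pr_intros) auto
  then show ?case
    by (rule primrec_in_cong) auto
qed

section \<open>Changing the oracle\<close>

fun oracle_subst :: "scheme \<Rightarrow> scheme \<Rightarrow> scheme" where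
  "oracle_subst r Oracle = r"
| "oracle_subst r (Comp p qs) = Comp (oracle_subst r p) (map (oracle_subst r) qs)"
| "oracle_subst r (PrimRec p q) = PrimRec (oracle_subst r p) (oracle_subst r q)"
| "oracle_subst r (Mu p) = Mu (oracle_subst r p)"
| "oracle_subst r s = s"

lemma primitive_oracle_subst:
  "primitive_scheme s \<Longrightarrow> primitive_scheme r \<Longrightarrow> primitive_scheme (oracle_subst r s)"
  by (induction r s rule: oracle_subst.induct) auto

lemma eval_oracle_subst:
  assumes "eval g s xs y" and "\<And>x. eval g' r [x] (g x)"
  shows "eval g' (oracle_subst r s) xs y"
  using assms(1)
proof (induction rule: eval.induct)
  case (Comp xs qs ys p z)
  then have "list_all2 (\<lambda>q y. eval g' q xs y) (map (oracle_subst r) qs) ys"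
    by (auto simp: list_all2_conv_all_nth)
  then show ?case using Comp by (auto intro: eval.Comp)
next
  case (Mu p n xs)
  then have "\<forall>m<n. \<exists>k. eval g' (oracle_subst r p) (m # xs) (Suc k)" by blast
  then show ?case using Mu by (auto intro: eval.Mu)
qed (auto intro: eval.intros assms(2))

lemma primrec_in_oracle:
  assumes "primrec_in g' (Suc 0) (\<lambda>xs. g (xs ! 0))" and "primrec_in g n F"
  shows "primrec_in g' n F"
proof -
  obtain r where r: "primitive_scheme r" "\<And>xs. length xs = Suc 0 \<Longrightarrow> eval g' r xs (g (xs ! 0))"
    using assms(1) unfolding primrec_in_def by blast
  obtain s where s: "primitive_scheme s" "\<And>xs. length xs = n \<Longrightarrow> eval g s xs (F xs)"
    using assms(2) unfolding primrec_in_def by blast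
  have "eval g' (oracle_subst r s) xs (F xs)" if "length xs = n" for xs
    using eval_oracle_subst[OF s(2)[OF that], of g' r] r(2)[of "[_]"] by auto
  then show ?thesis
    unfolding primrec_in_def using primitive_oracle_subst[OF s(1) r(1)] by blast
qed

lemma primrec_in_no_oracle: "primrec_in no_oracle n F \<Longrightarrow> primrec_in g n F"
  by (rule primrec_in_oracle[OF pr_const])

lemma computable_in_oracle:
  assumes "primrec_in g' (Suc 0) (\<lambda>xs. g (xs ! 0))" and "computable_in g n F"
  shows "computable_in g' n F"
proof -
  obtain r where r: "\<And>xs. length xs = Suc 0 \<Longrightarrow> eval g' r xs (g (xs ! 0))"
    using assms(1) unfolding primrec_in_def by blast
  obtain s where s: "\<And>xs. length xs = n \<Longrightarrow> eval g s xs (F xs)"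
    using assms(2) unfolding computable_in_def by blast
  have "eval g' (oracle_subst r s) xs (F xs)" if "length xs = n" for xs
    using eval_oracle_subst[OF s[OF that], of g' r] r[of "[_]"] by auto
  then show ?thesis
    unfolding computable_in_def by blast
qed

lemma PR_le_iff: "f \<le>\<^sub>P\<^sub>R g \<longleftrightarrow> primrec_in g (Suc 0) (\<lambda>xs. f (xs ! 0))"
  by (simp add: PR_le_def)

lemma PR_le_refl: "f \<le>\<^sub>P\<^sub>R f"
  unfolding PR_le_iff by (intro pr_oracle pr_nth) simp

lemma PR_le_trans: "f \<le>\<^sub>P\<^sub>R g \<Longrightarrow> g \<le>\<^sub>P\<^sub>R h \<Longrightarrow> f \<le>\<^sub>P\<^sub>R h"
  unfolding PR_le_iff by (rule primrec_in_oracle)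

lemma equiv_PR_equiv: "equiv UNIV PR_equiv"
  by (rule equivI) (auto simp: PR_equiv_def refl_on_def sym_def trans_def
      intro: PR_le_refl PR_le_trans)

lemma PR_le_degree_iff:
  assumes "d \<in> PR_degrees" and "g \<in> d"
  shows "f \<preceq>\<^sub>P\<^sub>R d \<longleftrightarrow> f \<le>\<^sub>P\<^sub>R g"
proof -
  have "g' \<le>\<^sub>P\<^sub>R g" if "g' \<in> d" for g'
    using assms that unfolding PR_degrees_def
    by (metis (no_types, lifting) PR_equiv_def case_prodD equiv_PR_equiv mem_Collect_eq
        quotient_eq_iff)
  then show ?thesis
    unfolding PR_le_degree_def using assms(2) PR_le_trans by blast
qed

lemma PR_degree_nonempty:
  assumes "d \<in> PR_degrees"
  obtains g where "g \<in> d"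
  using assms equiv_PR_equiv unfolding PR_degrees_def by (metis equals0I in_quotient_imp_non_empty)

section \<open>Evaluation in stages\<close>

inductive_cases eval_ZeroE: "eval g Zero xs y"
inductive_cases eval_SuccE: "eval g Succ xs y"
inductive_cases eval_ProjE: "eval g (Proj i) xs y"
inductive_cases eval_OracleE: "eval g Oracle xs y"
inductive_cases eval_CompE: "eval g (Comp p qs) xs y"
inductive_cases eval_PrimRecE: "eval g (PrimRec p q) xs y"
inductive_cases eval_PrimRec_0E: "eval g (PrimRec p q) (0 # xs) y"
inductive_cases eval_PrimRec_SucE: "eval g (PrimRec p q) (Suc n # xs) y"
inductive_cases eval_MuE: "eval g (Mu p) xs y"

text \<open>
  \<open>F (u # xs)\<close> is the successor of the value computed within \<open>u\<close> stages, and 0 if the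
  computation takes longer.
\<close>

definition stages :: "(nat \<Rightarrow> nat) \<Rightarrow> scheme \<Rightarrow> nat \<Rightarrow> (nat list \<Rightarrow> nat) \<Rightarrow> bool" where
  "stages g s n F \<longleftrightarrow> primrec_in g (Suc n) F \<and>
     (\<forall>xs. length xs = n \<longrightarrow>
        (\<forall>y. eval g s xs y \<longleftrightarrow> (\<exists>u. F (u # xs) = Suc y)) \<and>
        (\<forall>u v y. u \<le> v \<longrightarrow> F (u # xs) = Suc y \<longrightarrow> F (v # xs) = Suc y))"

lemma stagesI:
  assumes "primrec_in g (Suc n) F"
    and "\<And>xs y. length xs = n \<Longrightarrow> eval g s xs y \<Longrightarrow> \<exists>u. F (u # xs) = Suc y"
    and "\<And>xs u y. length xs = n \<Longrightarrow> F (u # xs) = Suc y \<Longrightarrow> eval g s xs y"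
    and "\<And>xs u v y. length xs = n \<Longrightarrow> u \<le> v \<Longrightarrow> F (u # xs) = Suc y \<Longrightarrow> F (v # xs) = Suc y"
  shows "stages g s n F"
  unfolding stages_def using assms by metis

lemma
  assumes "stages g s n F"
  shows stages_primrec: "primrec_in g (Suc n) F"
    and stages_complete: "length xs = n \<Longrightarrow> eval g s xs y \<Longrightarrow> \<exists>u. F (u # xs) = Suc y"
    and stages_sound: "length xs = n \<Longrightarrow> F (u # xs) = Suc y \<Longrightarrow> eval g s xs y"
    and stages_mono: "length xs = n \<Longrightarrow> u \<le> v \<Longrightarrow> F (u # xs) = Suc y \<Longrightarrow> F (v # xs) = Suc y"
  using assms unfolding stages_def by blast+

text \<open>For schemes applied to lists of unsuitable length.\<close>

lemma stages_never: "(\<And>xs y. length xs = n \<Longrightarrow> \<not> eval g s xs y) \<Longrightarrow> stages g s n (\<lambda>_. 0)"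
  by (rule stagesI) (auto intro: pr_const)

text \<open>Inner results carry a successor, hence the \<open>- 1\<close> before they are passed to
  \<open>P\<close>. A single stage number can serve all subcomputations because finitely many
  sufficient stages have a common bound.\<close>

lemma stages_Comp:
  assumes p: "stages g p (length qs) P" and q: "\<And>q. q \<in> set qs \<Longrightarrow> stages g q n (Q q)"
  shows "stages g (Comp p qs) n (\<lambda>zs. if \<forall>q\<in>set qs. Q q zs \<noteq> 0
    then P (zs ! 0 # map (\<lambda>q. Q q zs - 1) qs) else 0)" (is "stages _ _ _ ?F")
proof (rule stagesI)
  have "primrec_in g (Suc n) (\<lambda>zs. P (map (\<lambda>Q. Q zs) ((\<lambda>zs. zs ! 0) # map (\<lambda>q zs. Q q zs - 1) qs)))"
    using stages_primrec[OF p] stages_primrec[OF q]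
    by (intro pr_comp) (auto intro!: pr_nth pr_pred[unfolded One_nat_def])
  then have P: "primrec_in g (Suc n) (\<lambda>zs. P (zs ! 0 # map (\<lambda>q. Q q zs - 1) qs))"
    by (simp add: comp_def)
  have "primrec_in g (Suc n) (\<lambda>zs. of_bool (\<forall>q\<in>set qs. Q q zs \<noteq> 0))"
    using q
  proof (induction qs)
    case (Cons q qs)
    have "primrec_in g (Suc n) (\<lambda>zs. of_bool (\<forall>q\<in>set qs. Q q zs \<noteq> 0))"
      using Cons by auto
    moreover have "primrec_in g (Suc n) (\<lambda>zs. of_bool (Q q zs \<noteq> 0))"
      using Cons.prems by (intro pr_intros stages_primrec[of _ q]) auto
    ultimately have "primrec_in g (Suc n)
        (\<lambda>zs. of_bool (Q q zs \<noteq> 0 \<and> (\<forall>q\<in>set qs. Q q zs \<noteq> 0)))"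
      by (intro pr_conj)
    then show ?case by simp
  qed (use pr_const[of g "Suc n" 1] in simp)
  then show "primrec_in g (Suc n) ?F"
    by (intro pr_If P pr_const)
next
  fix xs y
  assume xs: "length xs = n" and "eval g (Comp p qs) xs y"
  from this(2) obtain ys
    where ys: "list_all2 (\<lambda>q y. eval g q xs y) qs ys" and y: "eval g p ys y"
    by (auto elim: eval_CompE)
  from y obtain u0 where u0: "P (u0 # ys) = Suc y"
    using stages_complete[OF p] ys by (metis list_all2_lengthD)
  have "\<forall>i<length qs. \<exists>u. Q (qs ! i) (u # xs) = Suc (ys ! i)"
    using stages_complete[OF q xs] ys by (auto simp: list_all2_conv_all_nth)
  then obtain u where u: "\<And>i. i < length qs \<Longrightarrow> Q (qs ! i) (u i # xs) = Suc (ys ! i)"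
    by metis
  obtain v where v: "u0 \<le> v" "\<And>i. i < length qs \<Longrightarrow> u i \<le> v"
    using finite_nat_set_iff_bounded_le[of "insert u0 (u ` {..<length qs})"] by auto
  have Q: "Q (qs ! i) (v # xs) = Suc (ys ! i)" if "i < length qs" for i
    using stages_mono[OF q xs v(2) u] that by simp
  then have "map (\<lambda>q. Q q (v # xs) - 1) qs = ys"
    using ys by (auto intro!: nth_equalityI simp: list_all2_conv_all_nth)
  moreover have "P (v # ys) = Suc y"
    using stages_mono[OF p _ v(1) u0] ys by (auto dest: list_all2_lengthD)
  moreover have "\<forall>q\<in>set qs. Q q (v # xs) \<noteq> 0"
    using Q by (auto simp: in_set_conv_nth)
  ultimately have "?F (v # xs) = Suc y" by simp
  then show "\<exists>u. ?F (u # xs) = Suc y" ..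
next
  fix xs u y
  assume xs: "length xs = n" and F: "?F (u # xs) = Suc y"
  then have Q: "\<And>q. q \<in> set qs \<Longrightarrow> Q q (u # xs) \<noteq> 0"
    and P: "P (u # map (\<lambda>q. Q q (u # xs) - 1) qs) = Suc y"
    by (auto split: if_splits)
  show "eval g (Comp p qs) xs y"
  proof (rule eval.Comp)
    show "list_all2 (\<lambda>q y. eval g q xs y) qs (map (\<lambda>q. Q q (u # xs) - 1) qs)"
      using Q stages_sound[OF q xs] by (auto simp: list_all2_conv_all_nth)
    show "eval g p (map (\<lambda>q. Q q (u # xs) - 1) qs) y"
      using stages_sound[OF p _ P] by simp
  qed
next
  fix xs u v y
  assume xs: "length xs = n" and uv: "u \<le> v" and F: "?F (u # xs) = Suc y"
  then have Q: "\<And>q. q \<in> set qs \<Longrightarrow> Q q (u # xs) \<noteq> 0"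
    and P: "P (u # map (\<lambda>q. Q q (u # xs) - 1) qs) = Suc y"
    by (auto split: if_splits)
  have Q': "Q q (v # xs) = Q q (u # xs)" if "q \<in> set qs" for q
    using stages_mono[OF q[OF that] xs uv] Q[OF that] by (metis not0_implies_Suc)
  then have eq: "map (\<lambda>q. Q q (v # xs) - 1) qs = map (\<lambda>q. Q q (u # xs) - 1) qs"
    by simp
  have "P (v # map (\<lambda>q. Q q (v # xs) - 1) qs) = Suc y"
    unfolding eq using stages_mono[OF p _ uv P] by simp
  then show "?F (v # xs) = Suc y"
    using Q Q' by simp
qed

text \<open>In \<open>zs\<close>, position 0 is the stage, position 1 the recursion counter, and the
  rest are parameters. A 0 marks an unfinished round and is passed on through all later
  rounds.\<close>

lemma stages_PrimRec:
  assumes p: "stages g p n P" and q: "stages g q (Suc (Suc n)) Q"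
  shows "stages g (PrimRec p q) (Suc n) (\<lambda>zs. rec_nat (P (zs ! 0 # drop 2 zs))
    (\<lambda>i y. if y = 0 then 0 else Q (zs ! 0 # i # (y - 1) # drop 2 zs)) (zs ! 1))"
    (is "stages _ _ _ (\<lambda>zs. ?R zs (zs ! 1))")
proof -
  have mono: "?R (v # k # xs) m = Suc y"
    if "length xs = n" "u \<le> v" "?R (u # k # xs) m = Suc y" for xs u v k m y
    using that(3)
  proof (induction m arbitrary: y)
    case 0
    then show ?case using stages_mono[OF p that(1,2)] by simp
  next
    case (Suc m)
    then obtain z where z: "?R (u # k # xs) m = Suc z" by (cases "?R (u # k # xs) m") auto
    then show ?case
      using Suc stages_mono[OF q _ that(2), of "m # z # xs"] that(1) by simp
  qed
  have sound: "eval g (PrimRec p q) (m # xs) y"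
    if "length xs = n" "?R (u # k # xs) m = Suc y" for xs u k m y
    using that(2)
  proof (induction m arbitrary: y)
    case 0
    then show ?case using stages_sound[OF p that(1)] by (auto intro: eval.PrimRec_0)
  next
    case (Suc m)
    then obtain z where z: "?R (u # k # xs) m = Suc z" by (cases "?R (u # k # xs) m") auto
    then show ?case
      using Suc stages_sound[OF q, of "m # z # xs"] that(1)
      by (auto intro: eval.PrimRec_Suc)
  qed
  have complete: "\<exists>u. ?R (u # k # xs) m = Suc y"
    if xs: "length xs = n" and y: "eval g (PrimRec p q) (m # xs) y" for xs k m y
    using y
  proof (induction m arbitrary: y)
    case 0
    then show ?case using stages_complete[OF p xs] by (auto elim: eval_PrimRec_0E)
  next
    case (Suc m)
    then obtain z where z: "eval g (PrimRec p q) (m # xs) z" "eval g q (m # z # xs) y"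
      by (auto elim: eval_PrimRec_SucE)
    obtain u where u: "?R (u # k # xs) m = Suc z"
      using Suc.IH[OF z(1)] ..
    obtain v where v: "Q (v # m # z # xs) = Suc y"
      using stages_complete[OF q _ z(2)] xs by auto
    have "?R (max u v # k # xs) m = Suc z"
      using mono[OF xs max.cobounded1 u] .
    moreover have "Q (max u v # m # z # xs) = Suc y"
      using stages_mono[OF q _ max.cobounded2 v] xs by simp
    ultimately have "?R (max u v # k # xs) (Suc m) = Suc y" by simp
    then show ?case ..
  qed
  show ?thesis
  proof (rule stagesI)
    have P: "primrec_in g (Suc (Suc n)) (\<lambda>zs. P (zs ! 0 # drop 2 zs))"
      by (intro pr_Cons_drop[OF stages_primrec[OF p]] pr_nth) auto
    have "primrec_in g (Suc (Suc (Suc (Suc n))))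
        (\<lambda>ws. Q (ws ! 2 # ws ! 0 # (ws ! 1 - 1) # drop 4 ws))"
      by (intro pr_Cons3_drop[OF stages_primrec[OF q]] pr_nth pr_pred) auto
    then have "primrec_in g (Suc (Suc (Suc (Suc n)))) (\<lambda>ws. if ws ! 1 = 0 then 0
        else Q (ws ! 2 # ws ! 0 # (ws ! 1 - 1) # drop 4 ws))"
      by (intro pr_intros) auto
    then have "primrec_in g (Suc (Suc (Suc (Suc n)))) (\<lambda>ws. if ws ! 1 = 0 then 0
        else Q (drop 2 ws ! 0 # ws ! 0 # (ws ! 1 - 1) # drop 2 (drop 2 ws)))"
      by (rule primrec_in_cong) simp
    then show "primrec_in g (Suc (Suc n)) (\<lambda>zs. ?R zs (zs ! 1))"
      by (intro pr_rec_nat P pr_nth) auto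
  next
    fix xs y
    assume "length xs = Suc n" and "eval g (PrimRec p q) xs y"
    then show "\<exists>u. ?R (u # xs) ((u # xs) ! 1) = Suc y"
      using complete by (cases xs) auto
  next
    fix xs u y
    assume "length xs = Suc n" and "?R (u # xs) ((u # xs) ! 1) = Suc y"
    then show "eval g (PrimRec p q) xs y"
      using sound by (cases xs) auto
  next
    fix xs u v y
    assume "length xs = Suc n" and "u \<le> v" and "?R (u # xs) ((u # xs) ! 1) = Suc y"
    then show "?R (v # xs) ((v # xs) ! 1) = Suc y"
      using mono by (cases xs) auto
  qed
qed

text \<open>The stage also bounds the search. The value 1 of \<open>P\<close> means convergence to 0
  and a larger value convergence to a positive number, so at most one \<open>k\<close> qualifies and
  the sum is \<open>Suc k\<close> or 0.\<close>

lemma stages_Mu: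
  assumes p: "stages g p (Suc n) P"
  shows "stages g (Mu p) n (\<lambda>zs. \<Sum>k<zs ! 0. Suc k *
    of_bool (P (zs ! 0 # k # drop 1 zs) = 1 \<and> (\<forall>m<k. 1 < P (zs ! 0 # m # drop 1 zs))))"
    (is "stages _ _ _ ?F")
proof -
  let ?C = "\<lambda>u xs k. P (u # k # xs) = 1 \<and> (\<forall>m<k. 1 < P (u # m # xs))"
  have F: "?F (u # xs) = Suc y \<longleftrightarrow> y < u \<and> ?C u xs y" for u xs y
  proof
    assume *: "y < u \<and> ?C u xs y"
    then have "?C u xs k \<longleftrightarrow> k = y" for k
      by (metis less_irrefl nat_neq_iff)
    then show "?F (u # xs) = Suc y"
      using * sum_unique[of y u "?C u xs" Suc] by simp
  next
    assume S: "?F (u # xs) = Suc y"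
    have "\<exists>k<u. ?C u xs k"
    proof (rule ccontr)
      assume "\<not> (\<exists>k<u. ?C u xs k)"
      then have "?F (u # xs) = 0" by (intro sum.neutral) auto
      with S show False by simp
    qed
    then obtain k where k: "k < u" "?C u xs k" by blast
    then have "?C u xs j \<longleftrightarrow> j = k" for j
      by (metis less_irrefl nat_neq_iff)
    then have "?F (u # xs) = Suc k"
      using k sum_unique[of k u "?C u xs" Suc] by simp
    then show "y < u \<and> ?C u xs y" using S k by simp
  qed
  show ?thesis
  proof (rule stagesI)
    have 1: "primrec_in g (Suc (Suc n)) (\<lambda>ws. P (ws ! 1 # ws ! 0 # drop 2 ws))"
      by (intro pr_Cons2_drop[OF stages_primrec[OF p]] pr_nth) auto
    have 2: "primrec_in g (Suc (Suc (Suc n))) (\<lambda>ws. P (ws ! 2 # ws ! 0 # drop 3 ws))"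
      by (intro pr_Cons2_drop[OF stages_primrec[OF p]] pr_nth) auto
    have "primrec_in g (Suc (Suc n)) (\<lambda>ws. of_bool (P (ws ! 1 # ws ! 0 # drop 2 ws) = 1 \<and>
        (\<forall>m<ws ! 0. 1 < P (ws ! 1 # m # drop 2 ws))))"
      by (intro pr_conj pr_eq pr_ball pr_less 1 pr_const pr_nth
          primrec_in_cong[OF 2]) (auto simp: numeral_eq_Suc)
    then have "primrec_in g (Suc (Suc n)) (\<lambda>ws. of_bool (P (drop 1 ws ! 0 # ws ! 0 # drop 1 (drop 1 ws)) = 1 \<and>
        (\<forall>m<ws ! 0. 1 < P (drop 1 ws ! 0 # m # drop 1 (drop 1 ws)))))"
      by (rule primrec_in_cong) (simp add: numeral_eq_Suc)
    then show "primrec_in g (Suc n) ?F"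
      by (intro pr_sum pr_mult pr_Suc pr_nth) auto
  next
    fix xs y
    assume xs: "length xs = n" and "eval g (Mu p) xs y"
    from this(2) have y: "eval g p (y # xs) 0" "\<forall>m<y. \<exists>k. eval g p (m # xs) (Suc k)"
      by (auto elim: eval_MuE)
    obtain u0 where u0: "P (u0 # y # xs) = 1"
      using stages_complete[OF p _ y(1)] xs by auto
    have "\<forall>m<y. \<exists>u k. P (u # m # xs) = Suc (Suc k)"
      using y(2) stages_complete[OF p] xs by (metis length_Cons)
    then obtain u k where u: "\<And>m. m < y \<Longrightarrow> P (u m # m # xs) = Suc (Suc (k m))"
      by metis
    obtain v where v: "y < v" "u0 \<le> v" "\<And>m. m < y \<Longrightarrow> u m \<le> v"
      using finite_nat_set_iff_bounded_le[of "insert (Suc y) (insert u0 (u ` {..<y}))"]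
      by (auto simp: Suc_le_eq)
    have "P (v # y # xs) = 1"
      using stages_mono[OF p _ v(2), of "y # xs"] u0 xs by simp
    moreover have "1 < P (v # m # xs)" if "m < y" for m
      using stages_mono[OF p _ v(3) u] xs that by simp
    ultimately show "\<exists>u. ?F (u # xs) = Suc y"
      using v(1) F by blast
  next
    fix xs u y
    assume xs: "length xs = n" and "?F (u # xs) = Suc y"
    from this(2) have y: "P (u # y # xs) = 1" "\<And>m. m < y \<Longrightarrow> 1 < P (u # m # xs)"
      unfolding F by auto
    show "eval g (Mu p) xs y"
    proof (rule eval.Mu)
      show "eval g p (y # xs) 0"
        using stages_sound[OF p, of "y # xs" u 0] y(1) xs by simp
      show "\<forall>m<y. \<exists>k. eval g p (m # xs) (Suc k)"
      proof (intro allI impI)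
        fix m assume "m < y"
        then obtain k where "P (u # m # xs) = Suc (Suc k)"
          using y(2) by (metis less_natE One_nat_def add_Suc)
        then show "\<exists>k. eval g p (m # xs) (Suc k)"
          using stages_sound[OF p, of "m # xs" u] xs by auto
      qed
    qed
  next
    fix xs u v y
    assume xs: "length xs = n" and uv: "u \<le> v" and "?F (u # xs) = Suc y"
    from this(3) have y: "y < u" "P (u # y # xs) = 1" "\<And>m. m < y \<Longrightarrow> 1 < P (u # m # xs)"
      unfolding F by auto
    have "P (v # k # xs) = P (u # k # xs)" if "P (u # k # xs) \<noteq> 0" for k
      using stages_mono[OF p _ uv, of "k # xs" "P (u # k # xs) - 1"] xs that by simp
    then show "?F (v # xs) = Suc y"
      unfolding F using y uv by (metis less_le_trans not_less_zero zero_neq_one)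
  qed
qed

lemma stages_exist: "\<exists>F. stages g s n F"
proof (induction s arbitrary: n)
  case Zero
  have "stages g Zero n (\<lambda>_. 1)"
    by (rule stagesI) (auto intro: pr_const eval.Zero elim: eval_ZeroE)
  then show ?case by blast
next
  case Succ
  show ?case
  proof (cases "n = 1")
    case True
    have "stages g Succ n (\<lambda>zs. Suc (Suc (zs ! 1)))"
      by (rule stagesI)
        (auto intro!: pr_intros eval.Succ elim!: eval_SuccE simp: True length_Suc_conv)
    then show ?thesis by blast
  next
    case False
    then have "stages g Succ n (\<lambda>_. 0)"
      by (intro stages_never) (auto elim: eval_SuccE)
    then show ?thesis by blast
  qed
next
  case (Proj i)
  show ?case
  proof (cases "i < n")
    case True
    have "stages g (Proj i) n (\<lambda>zs. Suc (zs ! Suc i))"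
      using True by (intro stagesI) (auto intro!: pr_intros eval.Proj elim!: eval_ProjE)
    then show ?thesis by blast
  next
    case False
    then have "stages g (Proj i) n (\<lambda>_. 0)"
      by (intro stages_never) (auto elim: eval_ProjE)
    then show ?thesis by blast
  qed
next
  case Oracle
  show ?case
  proof (cases "n = 1")
    case True
    have "stages g Oracle n (\<lambda>zs. Suc (g (zs ! 1)))"
      by (rule stagesI) (auto intro!: pr_intros pr_oracle eval.Oracle elim!: eval_OracleE
          simp: True length_Suc_conv)
    then show ?thesis by blast
  next
    case False
    then have "stages g Oracle n (\<lambda>_. 0)"
      by (intro stages_never) (auto elim: eval_OracleE)
    then show ?thesis by blast
  qed
next
  case (Comp p qs)
  obtain P where P: "stages g p (length qs) P"
    using Comp.IH(1) by blast
  have "\<exists>Q. \<forall>q\<in>set qs. stages g q n (Q q)"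
    using Comp.IH(2) by (intro bchoice) blast
  then show ?case
    using stages_Comp[OF P] by blast
next
  case (PrimRec p q)
  show ?case
  proof (cases n)
    case 0
    then have "stages g (PrimRec p q) n (\<lambda>_. 0)"
      by (intro stages_never) (auto elim: eval_PrimRecE)
    then show ?thesis by blast
  next
    case (Suc m)
    then show ?thesis using PrimRec stages_PrimRec by blast
  qed
next
  case (Mu p)
  then show ?case using stages_Mu by blast
qed

text \<open>
  The values of \<open>t\<close> bound both the witness of convergence and the value of \<open>f\<close>, so that a bounded
  search recovers \<open>f\<close> from any bound on \<open>t\<close>.
\<close>

lemma Delta01_time_function:
  assumes "Delta01_fun_in no_oracle f"
  obtains t where "mono t"
    and "primrec_in no_oracle 2 (\<lambda>xs. of_bool (t (xs ! 0) = xs ! 1))"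
    and "\<And>g h. h \<le>\<^sub>P\<^sub>R g \<Longrightarrow> (\<And>n. t n \<le> h n) \<Longrightarrow> f \<le>\<^sub>P\<^sub>R g"
proof -
  obtain S s where s: "\<And>xs. length xs = 3 \<Longrightarrow> eval no_oracle s xs (of_bool (S xs))"
    and S: "\<And>x y. f x = y \<longleftrightarrow> (\<exists>z. S [z, x, y])"
  proof -
    obtain S where S: "computable_in no_oracle (Suc 2) (\<lambda>xs. of_bool (S xs))"
      "\<And>xs. length xs = 2 \<Longrightarrow> f (xs ! 0) = xs ! 1 \<longleftrightarrow> (\<exists>z. S (z # xs))"
      using assms unfolding Delta01_fun_in_def Delta01_in_def Sigma01_in_def by blast
    then obtain s where "\<And>xs. length xs = 3 \<Longrightarrow> eval no_oracle s xs (of_bool (S xs))"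
      unfolding computable_in_def by auto
    moreover have "f x = y \<longleftrightarrow> (\<exists>z. S [z, x, y])" for x y
      using S(2)[of "[x, y]"] by simp
    ultimately show ?thesis using that by blast
  qed
  obtain F where F: "stages no_oracle s 3 F"
    using stages_exist by blast
  \<comment> \<open>The value 2 codes the output 1, that is, truth of \<open>S\<close>. A different
    output is refuted by comparing both at a common stage.\<close>
  have F_S: "S [z, x, y]" if "F [u, z, x, y] = 2" for u z x y
  proof (rule ccontr)
    assume "\<not> S [z, x, y]"
    then have "eval no_oracle s [z, x, y] 0" using s[of "[z, x, y]"] by simp
    then obtain v where v: "F [v, z, x, y] = Suc 0"
      using stages_complete[OF F, of "[z, x, y]"] by auto
    have "F [max u v, z, x, y] = Suc 0" "F [max u v, z, x, y] = Suc 1"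
      using stages_mono[OF F _ max.cobounded2 v, of u]
        stages_mono[OF F, of "[z, x, y]" u "max u v" 1] that by (auto simp: numeral_eq_Suc)
    then show False by simp
  qed
  define Q where "Q u x \<longleftrightarrow> (\<exists>z<u. \<exists>y<u. F [u, z, x, y] = 2)" for u x
  have Q_mono: "Q v x" if "Q u x" "u \<le> v" for u v x
    using that stages_mono[OF F, of "[_, _, _]" u v 1] unfolding Q_def
    by (auto simp: numeral_eq_Suc) (meson less_le_trans)
  have Q_ex: "\<exists>u. Q u x" for x
  proof -
    obtain z where z: "S [z, x, f x]" using S by blast
    then obtain u where u: "F [u, z, x, f x] = Suc 1"
      using stages_complete[OF F, of "[z, x, f x]"] s[of "[z, x, f x]"] by auto
    let ?v = "Suc (max u (max z (f x)))"
    have "F [?v, z, x, f x] = Suc 1"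
      using stages_mono[OF F _ _ u, of ?v] by simp
    then have "Q ?v x" unfolding Q_def
      by (intro exI[of _ z] exI[of _ "f x"] conjI) auto
    then show ?thesis by blast
  qed
  have Q_all: "\<exists>u. \<forall>i<Suc n. Q u i" for n
  proof -
    obtain u where u: "\<And>i. Q (u i) i" using Q_ex by metis
    obtain v where "\<And>i. i < Suc n \<Longrightarrow> u i \<le> v"
      using finite_nat_set_iff_bounded_le[of "u ` {..<Suc n}"] by auto
    then show ?thesis using Q_mono[OF u] by blast
  qed
  \<comment> \<open>Treating all arguments up to \<open>n\<close> at once makes \<open>t\<close>
    nondecreasing.\<close>
  define t where "t n = (LEAST u. \<forall>i<Suc n. Q u i)" for n
  have t: "\<forall>i<Suc n. Q (t n) i" for n
    unfolding t_def by (rule LeastI_ex[OF Q_all])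
  have pr_F: "primrec_in g n (\<lambda>xs. F [A xs, B xs, C xs, D xs])"
    if "primrec_in g n A" "primrec_in g n B" "primrec_in g n C" "primrec_in g n D" for g n A B C D
    using pr_comp[of g "[A, B, C, D]" F n] that primrec_in_no_oracle[OF stages_primrec[OF F]]
    by (auto simp: numeral_eq_Suc)
  show thesis
  proof (rule that)
    show "mono t"
    proof (rule monoI)
      fix m n :: nat assume "m \<le> n"
      then have "\<forall>i<Suc m. Q (t n) i" using t[of n] by simp
      then show "t m \<le> t n" unfolding t_def[of m] by (rule Least_le)
    qed
    \<comment> \<open>Leastness of a given \<open>u\<close> is a bounded statement, so the graph is
      primitive recursive even if \<open>t\<close> is not.\<close>
    have "t n = u \<longleftrightarrow> (\<forall>i<Suc n. Q u i) \<and> (\<forall>v<u. \<not> (\<forall>i<Suc n. Q v i))" for n u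
      using t[of n] not_less_Least[of _ "\<lambda>u. \<forall>i<Suc n. Q u i"] unfolding t_def[symmetric]
      by (metis nat_neq_iff)
    moreover have "primrec_in no_oracle 2 (\<lambda>xs. of_bool
      ((\<forall>i<Suc (xs ! 0). Q (xs ! 1) i) \<and> (\<forall>v<xs ! 1. \<not> (\<forall>i<Suc (xs ! 0). Q v i))))"
      unfolding Q_def by (intro pr_intros pr_F; simp)
    ultimately show "primrec_in no_oracle 2 (\<lambda>xs. of_bool (t (xs ! 0) = xs ! 1))"
      by simp
  next
    fix g h assume h: "h \<le>\<^sub>P\<^sub>R g" "\<And>n. t n \<le> h n"
    \<comment> \<open>\<open>h x\<close> bounds the search, and by \<open>F_S\<close> the only
      \<open>y\<close> that can be found is \<open>f x\<close>.\<close>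
    let ?U = "\<lambda>x. \<Sum>y<h x. y * of_bool (\<exists>z<h x. F [h x, z, x, y] = 2)"
    have pr_h: "primrec_in g n (\<lambda>xs. h (A xs))" if "primrec_in g n A" for n A
      using pr_comp1[of g h] h(1) that unfolding PR_le_iff by blast
    have "primrec_in g (Suc 0) (\<lambda>xs. ?U (xs ! 0))"
      by (intro pr_intros pr_F pr_h; simp)
    moreover have "?U x = f x" for x
    proof -
      have Q: "Q (h x) x" using Q_mono t[of x] h(2) by blast
      have f: "y = f x" if "F [h x, z, x, y] = 2" for z y
        using F_S[OF that] S by metis
      then show ?thesis using Q unfolding Q_def by (intro sum_unique) auto
    qed
    ultimately show "f \<le>\<^sub>P\<^sub>R g" unfolding PR_le_iff by simp
  qed
qed

section \<open>The upper bound\<close>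

lemma isomorphism_inv:
  assumes "isomorphism A B f"
  shows "isomorphism B A (inv f)"
  using assms unfolding isomorphism_def
  by (metis bij_imp_bij_inv bij_inv_eq_iff)

lemma isomorphism_comp:
  assumes "isomorphism A B f" and "isomorphism B C h"
  shows "isomorphism A C (h \<circ> f)"
  using assms unfolding isomorphism_def by (auto intro: bij_comp)

lemma isomorphic_sym: "isomorphic A B \<Longrightarrow> isomorphic B A"
  unfolding isomorphic_def using isomorphism_inv by blast

lemma isomorphic_trans: "isomorphic A B \<Longrightarrow> isomorphic B C \<Longrightarrow> isomorphic A C"
  unfolding isomorphic_def using isomorphism_comp by blast

lemma Delta01_fun_in_inv:
  assumes "Delta01_fun_in g f" and "bij f"
  shows "Delta01_fun_in g (inv f)"
proof -
  have swap: "Sigma01_in g 2 (\<lambda>xs. P (xs ! 1) (xs ! 0))"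
    if P: "Sigma01_in g 2 (\<lambda>xs. P (xs ! 0) (xs ! 1))" for P :: "nat \<Rightarrow> nat \<Rightarrow> bool"
  proof -
    obtain S where S: "computable_in g (Suc 2) (\<lambda>xs. of_bool (S xs))"
      "\<And>xs. length xs = 2 \<Longrightarrow> P (xs ! 0) (xs ! 1) \<longleftrightarrow> (\<exists>z. S (z # xs))"
      using P unfolding Sigma01_in_def by blast
    obtain s where s: "\<And>xs. length xs = Suc 2 \<Longrightarrow> eval g s xs (of_bool (S xs))"
      using S(1) unfolding computable_in_def by blast
    \<comment> \<open>Position 0 holds the existential witness and stays; the two arguments of the
      graph change places.\<close>
    have "eval g (Comp s [Proj 0, Proj 2, Proj 1]) xs (of_bool (S [xs ! 0, xs ! 2, xs ! 1]))"
      if "length xs = Suc 2" for xs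
      using that s[of "[xs ! 0, xs ! 2, xs ! 1]"]
      by (intro eval.Comp[where ys = "[xs ! 0, xs ! 2, xs ! 1]"]) (auto intro: eval.Proj)
    then have "computable_in g (Suc 2) (\<lambda>xs. of_bool (S [xs ! 0, xs ! 2, xs ! 1]))"
      unfolding computable_in_def by blast
    moreover have "P (xs ! 1) (xs ! 0) \<longleftrightarrow> (\<exists>z. S [z, xs ! 1, xs ! 0])" for xs
      using S(2)[of "[xs ! 1, xs ! 0]"] by simp
    ultimately show ?thesis
      unfolding Sigma01_in_def
      by (intro exI[of _ "\<lambda>xs. S [xs ! 0, xs ! 2, xs ! 1]"]) (simp add: numeral_2_eq_2)
  qed
  have "inv f x = y \<longleftrightarrow> f y = x" for x y
    using assms(2) by (metis bij_inv_eq_iff)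
  then show ?thesis
    using assms(1) swap[of "\<lambda>x y. f x = y"] swap[of "\<lambda>x y. f x \<noteq> y"]
    unfolding Delta01_fun_in_def Delta01_in_def Pi01_in_def by simp
qed

lemma Delta01_fun_in_atomic_diagram:
  assumes "punctual B" and "Delta01_fun_in (atomic_diagram B) f"
  shows "Delta01_fun_in no_oracle f"
proof -
  have "primrec_in no_oracle (Suc 0) (\<lambda>xs. of_bool
      ((fst (prod_decode (xs ! 0)), snd (prod_decode (xs ! 0))) \<in> B))"
    using assms(1) unfolding punctual_def numeral_2_eq_2
    by (rule pr_comp2) (intro pr_fst_decode pr_snd_decode pr_nth; simp)+
  then have "primrec_in no_oracle (Suc 0) (\<lambda>xs. atomic_diagram B (xs ! 0))"
    by (simp add: atomic_diagram_def)
  then show ?thesis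
    using assms(2) computable_in_oracle
    unfolding Delta01_fun_in_def Delta01_in_def Pi01_in_def Sigma01_in_def by meson
qed

lemma Cone_subset_PrCat:
  assumes "rel_Delta01_categorical E"
  shows "Cone_Delta01 \<subseteq> PrCat E"
proof
  fix d assume d: "d \<in> Cone_Delta01"
  have "\<exists>f. isomorphism E B f \<and> f \<preceq>\<^sub>P\<^sub>R d \<and> inv f \<preceq>\<^sub>P\<^sub>R d" if B: "punctual B" "isomorphic B E" for B
  proof -
    obtain f where f: "isomorphism B E f" "Delta01_fun_in (atomic_diagram B) f"
      using assms B(2) unfolding rel_Delta01_categorical_def by blast
    then have "bij f" "Delta01_fun_in no_oracle f"
      using Delta01_fun_in_atomic_diagram[OF B(1)] by (auto simp: isomorphism_def)
    then have "f \<preceq>\<^sub>P\<^sub>R d" "inv f \<preceq>\<^sub>P\<^sub>R d" "inv (inv f) = f"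
      using d Delta01_fun_in_inv unfolding Cone_Delta01_def by (auto intro: inv_inv_eq)
    \<comment> \<open>\<open>PrCat\<close> asks for maps out of \<open>E\<close>, whereas
      categoricity supplies maps into \<open>E\<close>; hence \<open>inv f\<close> is the
      isomorphism and \<open>f\<close> its inverse.\<close>
    then show ?thesis using isomorphism_inv[OF f(1)] by metis
  qed
  then show "d \<in> PrCat E"
    using d unfolding PrCat_def Cone_Delta01_def by blast
qed

section \<open>Punctual categoricity\<close>

text \<open>
  Any isomorphism can be changed into one that is the identity from some point on: only its
  values at the finitely many points corresponding to \<open>D\<close> matter.
\<close>

lemma punctually_categorical_finite_support:
  assumes "finite D"
    and auto: "\<And>\<pi>. bij \<pi> \<Longrightarrow> (\<And>x. x \<in> D \<Longrightarrow> \<pi> x = x) \<Longrightarrow>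
      (\<And>x y. (x, y) \<in> E \<longleftrightarrow> (\<pi> x, \<pi> y) \<in> E)"
  shows "punctually_categorical E"
  unfolding punctually_categorical_def
proof (intro allI impI, elim conjE)
  fix B C
  assume "isomorphic B E" and "isomorphic C E"
  then obtain u v where u: "isomorphism B E u" and v: "isomorphism C E v"
    unfolding isomorphic_def by blast
  then have bij: "bij u" "bij v" by (auto simp: isomorphism_def)
  define h where "h = inv v \<circ> u"
  have h: "bij h" using bij by (simp add: h_def bij_comp bij_imp_bij_inv)
  define D' where "D' = u -` D"
  have "finite D'" unfolding D'_def
    using assms(1) bij by (intro finite_vimageI) (auto simp: bij_def)
  then obtain N where N: "D' \<union> h ` D' \<subseteq> {..<N}"
    using finite_nat_set_iff_bounded[of "D' \<union> h ` D'"] by auto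
  \<comment> \<open>Counting what is left over: \<open>h\<close> on \<open>D'\<close> can be
    completed to a permutation of \<open>{..<N}\<close>, since equally many points remain on both
    sides.\<close>
  have "card (h ` D') = card D'"
    using h by (intro card_image) (auto simp: bij_def inj_on_def)
  then have "card ({..<N} - D') = card ({..<N} - h ` D')"
    using N \<open>finite D'\<close> by (simp add: card_Diff_subset)
  then obtain e where e: "bij_betw e ({..<N} - D') ({..<N} - h ` D')"
    using finite_same_card_bij by (metis finite_Diff finite_lessThan)
  define w where "w x = (if x \<in> D' then h x else e x)" for x
  have "bij_betw w D' (h ` D')"
    using h by (auto simp: bij_betw_def inj_on_def bij_def w_def)
  moreover have "bij_betw w ({..<N} - D') ({..<N} - h ` D')"
    using e by (subst bij_betw_cong[of _ _ e]) (auto simp: w_def)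
  ultimately have w: "bij_betw w {..<N} {..<N}"
    using bij_betw_combine[of w D' "h ` D'" "{..<N} - D'" "{..<N} - h ` D'"] N
    by (simp add: Un_absorb1 Un_Diff_cancel Diff_disjoint)
  define h' where "h' x = (if x < N then w x else x)" for x
  have "bij_betw h' {..<N} {..<N}"
    using w by (subst bij_betw_cong[of _ _ w]) (auto simp: h'_def)
  moreover have "bij_betw h' {N..} {N..}"
    by (subst bij_betw_cong[of _ _ id]) (auto simp: h'_def)
  ultimately have "bij_betw h' ({..<N} \<union> {N..}) ({..<N} \<union> {N..})"
    by (rule bij_betw_combine) auto
  moreover have "{..<N} \<union> {N..} = UNIV" by auto
  ultimately have h': "bij h'" by simp
  have "isomorphism B C h'"
    unfolding isomorphism_def
  proof (intro conjI allI h')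
    fix x y
    \<comment> \<open>Transported to \<open>E\<close>, the map \<open>h'\<close> becomes a
      permutation fixing \<open>D\<close> pointwise, because on \<open>D'\<close> it agrees with
      \<open>inv v \<circ> u\<close>.\<close>
    have "(u x, u y) \<in> E \<longleftrightarrow> ((v \<circ> h' \<circ> inv u) (u x), (v \<circ> h' \<circ> inv u) (u y)) \<in> E"
    proof (rule auto)
      show "bij (v \<circ> h' \<circ> inv u)" using bij h' by (simp add: bij_comp bij_imp_bij_inv)
      fix a assume "a \<in> D"
      then have "inv u a \<in> D'" using bij by (simp add: D'_def bij_is_surj surj_f_inv_f)
      then have "h' (inv u a) = h (inv u a)" using N by (auto simp: h'_def w_def)
      then show "(v \<circ> h' \<circ> inv u) a = a"
        using bij by (simp add: h_def bij_is_surj surj_f_inv_f)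
    qed
    then show "(x, y) \<in> B \<longleftrightarrow> (h' x, h' y) \<in> C"
      using u v bij by (simp add: isomorphism_def bij_is_inj)
  qed
  moreover have "primrec_fun h'"
    unfolding primrec_fun_def h'_def
    using pr_finite_modification[of no_oracle "\<lambda>x. x" N w] by (simp add: pr_nth)
  moreover have "inv h' x = (if x < N then inv h' x else x)" for x
    using h' by (metis bij_inv_eq_iff h'_def)
  then have "primrec_fun (inv h')"
    unfolding primrec_fun_def
    using pr_finite_modification[of no_oracle "\<lambda>x. x" N "inv h'"] by (simp add: pr_nth)
  ultimately show "\<exists>f. isomorphism B C f \<and> primrec_fun f \<and> primrec_fun (inv f)"
    by blast
qed

section \<open>Diagonalising against relative categoricity\<close>

text \<open>Both values are present at a common stage.\<close>

lemma eval_deterministic: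
  assumes "eval g s xs y" and "eval g s xs y'"
  shows "y = y'"
proof -
  obtain F where F: "stages g s (length xs) F" using stages_exist by blast
  obtain u v where u: "F (u # xs) = Suc y" and v: "F (v # xs) = Suc y'"
    using stages_complete[OF F refl] assms by blast
  show ?thesis
    using stages_mono[OF F refl max.cobounded1 u, of v] stages_mono[OF F refl max.cobounded2 v, of u]
    by simp
qed

text \<open>The use principle: a finished computation has consulted only finitely many oracle
  values, so it survives changes of the copy beyond a finite part.\<close>

lemma eval_use:
  assumes "eval g s xs y"
  shows "\<exists>n. \<forall>g'. (\<forall>i<n. g' i = g i) \<longrightarrow> eval g' s xs y"
  using assms
proof (induction rule: eval.induct)
  case (Oracle x)
  have "eval g' scheme.Oracle [x] (g x)" if "\<forall>i<Suc x. g' i = g i" for g'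
    using that eval.Oracle[of g' x] by simp
  then show ?case by blast
next
  case (Comp xs qs ys p z)
  then obtain n where n: "\<And>g'. (\<forall>i<n. g' i = g i) \<Longrightarrow> eval g' p ys z" by blast
  have "\<forall>j<length qs. \<exists>m. \<forall>g'. (\<forall>i<m. g' i = g i) \<longrightarrow> eval g' (qs ! j) xs (ys ! j)"
    using list_all2_nthD[OF Comp.IH(1)] by blast
  then obtain m where m: "\<And>j g'. j < length qs \<Longrightarrow> (\<forall>i<m j. g' i = g i) \<Longrightarrow>
      eval g' (qs ! j) xs (ys ! j)"
    by metis
  obtain b where b: "n \<le> b" "\<And>j. j < length qs \<Longrightarrow> m j \<le> b"
    using finite_nat_set_iff_bounded_le[of "insert n (m ` {..<length qs})"] by auto
  have "eval g' (scheme.Comp p qs) xs z" if g': "\<forall>i<b. g' i = g i" for g'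
  proof (rule eval.Comp)
    show "list_all2 (\<lambda>q y. eval g' q xs y) qs ys"
      unfolding list_all2_conv_all_nth
    proof (intro conjI allI impI)
      show "length qs = length ys"
        using Comp.IH(1) by (rule list_all2_lengthD)
      show "eval g' (qs ! j) xs (ys ! j)" if "j < length qs" for j
        using m[OF that] b(2)[OF that] g' by auto
    qed
    show "eval g' p ys z" using n b(1) g' by auto
  qed
  then show ?case by blast
next
  case (PrimRec_0 p xs y q)
  then show ?case using eval.PrimRec_0 by blast
next
  case (PrimRec_Suc p q n xs y z)
  then obtain a b where a: "\<And>g'. (\<forall>i<a. g' i = g i) \<Longrightarrow> eval g' (PrimRec p q) (n # xs) y"
    and b: "\<And>g'. (\<forall>i<b. g' i = g i) \<Longrightarrow> eval g' q (n # y # xs) z" by blast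
  have "eval g' (PrimRec p q) (Suc n # xs) z" if "\<forall>i<max a b. g' i = g i" for g'
    using that by (intro eval.PrimRec_Suc[OF a b]) auto
  then show ?case by blast
next
  case (Mu p n xs)
  then obtain a where a: "\<And>g'. (\<forall>i<a. g' i = g i) \<Longrightarrow> eval g' p (n # xs) 0" by blast
  have "\<forall>j<n. \<exists>k m. \<forall>g'. (\<forall>i<m. g' i = g i) \<longrightarrow> eval g' p (j # xs) (Suc k)"
    using Mu.IH(2) by blast
  then obtain k m where m: "\<And>j g'. j < n \<Longrightarrow> (\<forall>i<m j. g' i = g i) \<Longrightarrow>
      eval g' p (j # xs) (Suc (k j))"
    by metis
  obtain b where b: "a \<le> b" "\<And>j. j < n \<Longrightarrow> m j \<le> b"
    using finite_nat_set_iff_bounded_le[of "insert a (m ` {..<n})"] by auto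
  have "eval g' (scheme.Mu p) xs n" if g': "\<forall>i<b. g' i = g i" for g'
  proof (rule eval.Mu)
    show "eval g' p (n # xs) 0" using a b(1) g' by auto
    show "\<forall>j<n. \<exists>k. eval g' p (j # xs) (Suc k)"
    proof (intro allI impI)
      fix j assume "j < n"
      then show "\<exists>k. eval g' p (j # xs) (Suc k)"
        using m[of j g'] b(2)[of j] g' by auto
    qed
  qed
  then show ?case by blast
qed (auto intro: eval.Zero eval.Succ eval.Proj)

lemma quotient_eq_class:
  assumes "equiv UNIV E" and "X \<in> UNIV // E" and "x \<in> X"
  shows "X = E `` {x}"
proof -
  obtain z where "X = E `` {z}" using assms(2) by (rule quotientE)
  with assms(3) show ?thesis using equiv_class_eq[OF assms(1), of z x] by simp
qed

lemma quotient_mem_iff: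
  "equiv UNIV E \<Longrightarrow> X \<in> UNIV // E \<Longrightarrow> x \<in> X \<Longrightarrow> (x, y) \<in> E \<longleftrightarrow> y \<in> X"
  using quotient_eq_class[of E X x] by simp

text \<open>Class size is the invariant by which candidate isomorphisms are refuted in the
  diagonalisation and by which the class mapped to the filler is seen to be infinite.\<close>

lemma isomorphism_class_eqpoll:
  assumes "isomorphism A B f"
  shows "A `` {x} \<approx> B `` {f x}"
proof -
  have "f ` (A `` {x}) = B `` {f x}"
  proof (intro set_eqI iffI)
    fix y assume "y \<in> B `` {f x}"
    moreover obtain z where "y = f z"
      using assms by (metis bij_pointE isomorphism_def)
    ultimately show "y \<in> f ` (A `` {x})"
      using assms by (auto simp: isomorphism_def)
  qed (use assms in \<open>auto simp: isomorphism_def\<close>)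
  moreover have "inj_on f (A `` {x})"
    using assms by (auto simp: isomorphism_def bij_def inj_on_def)
  ultimately show ?thesis
    using inj_on_image_eqpoll_self eqpoll_sym by metis
qed

lemma isomorphism_inv_image: "bij p \<Longrightarrow> isomorphism (inv_image E p) E p"
  by (simp add: isomorphism_def)

text \<open>Only one half of the \<open>\<Delta>\<^sub>1\<close> definition of an isomorphism is needed: its graph is enumerable.\<close>

definition defeats :: "nat rel \<Rightarrow> scheme \<Rightarrow> (nat \<Rightarrow> nat) \<Rightarrow> bool" where
  "defeats E s p \<longleftrightarrow> \<not> (\<exists>f. isomorphism (inv_image E p) E f \<and>
     (\<forall>x y. f x = y \<longleftrightarrow> (\<exists>z. eval (atomic_diagram (inv_image E p)) s [z, x, y] 1)))"

text \<open>Lists are the forcing conditions: finite initial parts of a permutation along which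
  \<open>E\<close> is pulled back.\<close>

definition extends :: "(nat \<Rightarrow> nat) \<Rightarrow> nat list \<Rightarrow> bool" where
  "extends p l \<longleftrightarrow> bij p \<and> (\<forall>i<length l. p i = l ! i)"

text \<open>
  Either no permutation extending \<open>ps @ [c]\<close> has a computation that finds an image of the new
  point in a class of the right size, or such a computation only uses finitely much information,
  which remains correct when the class of the new point is moved into a larger one.
\<close>

lemma defeats_extension:
  assumes E: "equiv UNIV E" and ps: "distinct ps"
    and large: "\<And>R. finite R \<Longrightarrow> \<exists>C\<in>UNIV // E. finite C \<and> C \<inter> R = {} \<and>
      (\<forall>R'. finite R' \<longrightarrow> (\<exists>C'\<in>UNIV // E. C' \<inter> R' = {} \<and> (finite C' \<longrightarrow> card C < card C')))"
  shows "\<exists>qs. distinct (ps @ qs) \<and> (\<forall>p. extends p (ps @ qs) \<longrightarrow> defeats E s p)"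
proof -
  obtain C where C: "C \<in> UNIV // E" "finite C" "C \<inter> set ps = {}"
    and C': "\<And>R'. finite R' \<Longrightarrow>
      \<exists>C'\<in>UNIV // E. C' \<inter> R' = {} \<and> (finite C' \<longrightarrow> card C < card C')"
    using large[of "set ps"] by auto
  obtain c where c: "c \<in> C"
    using C(1) E by (metis equals0I in_quotient_imp_non_empty)
  define a where "a = length ps"
  show ?thesis
  proof (cases "\<exists>p z y. extends p (ps @ [c]) \<and> eval (atomic_diagram (inv_image E p)) s [z, a, y] 1 \<and>
      C \<approx> E `` {y}")
    case True
    then obtain p z y where p: "extends p (ps @ [c])"
      and z: "eval (atomic_diagram (inv_image E p)) s [z, a, y] 1" and y: "C \<approx> E `` {y}"
      by blast
    have inj: "p i = p j \<longleftrightarrow> i = j" for i j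
      using p by (auto simp: extends_def bij_def inj_eq)
    have pa: "p a = c" and p_ps: "\<And>i. i < a \<Longrightarrow> p i = ps ! i"
      using p by (auto simp: extends_def a_def nth_append)
    obtain n0 where n0: "\<And>g'. (\<forall>i<n0. g' i = atomic_diagram (inv_image E p) i) \<Longrightarrow>
        eval g' s [z, a, y] 1"
      using eval_use[OF z] by blast
    \<comment> \<open>Besides the use \<open>n0\<close>, the point \<open>a\<close> itself must lie
      below \<open>N\<close>, so that the new condition fixes the class of \<open>a\<close>.\<close>
    define N where "N = max (Suc a) n0"
    obtain D where D: "D \<in> UNIV // E" "D \<inter> p ` {..<N} = {}" "finite D \<longrightarrow> card C < card D"
      using C'[of "p ` {..<N}"] by auto
    have "C \<lesssim> D"
    proof (cases "finite D")
      case True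
      then show ?thesis using D(3) C(2) by (simp add: lepoll_iff_card_le)
    qed (use C(2) finite_lepoll_infinite in auto)
    then obtain \<sigma> where \<sigma>: "inj_on \<sigma> C" "\<sigma> ` C \<subseteq> D" by (auto simp: lepoll_def)
    \<comment> \<open>All members of \<open>C\<close> listed below \<open>N\<close> move into
      \<open>D\<close>, which contains no listed point. Hence no two points collide and no atomic
      fact among them changes.\<close>
    define q where "q i = (if p i \<in> C then \<sigma> (p i) else p i)" for i
    have q_ps: "q i = ps ! i" if "i < a" for i
    proof -
      have "ps ! i \<notin> C" using that C(3) by (auto simp: a_def)
      then show ?thesis using p_ps[OF that] by (simp add: q_def)
    qed
    have D_p: "p i \<notin> D" if "i < N" for i using D(2) that by blast
    have \<sigma>_D: "\<sigma> x \<in> D" if "x \<in> C" for x using \<sigma>(2) that by blast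
    have "inj_on q {0..<N}"
    proof (rule inj_onI)
      fix i j assume "i \<in> {0..<N}" and "j \<in> {0..<N}" and "q i = q j"
      then show "i = j"
        using D_p \<sigma>_D \<sigma>(1) by (auto simp: q_def inj dest: inj_onD split: if_splits) metis+
    qed
    then have dist: "distinct (map q [0..<N])" by (simp add: distinct_map)
    have "[0..<N] = [0..<a] @ [a..<N]"
      by (metis N_def less_imp_le_nat lessI max.coboundedI1 upt_add_eq_append le0 le_add_diff_inverse
          le_Suc_eq)
    moreover have "map q [0..<a] = ps"
      using q_ps by (auto intro: nth_equalityI simp: a_def)
    ultimately have list: "map q [0..<N] = ps @ map q [a..<N]" by simp
    have "defeats E s p'" if p': "extends p' (map q [0..<N])" for p'
      unfolding defeats_def
    proof (intro notI, elim exE conjE)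
      fix f
      assume f: "isomorphism (inv_image E p') E f"
        and graph: "\<forall>x y. f x = y \<longleftrightarrow> (\<exists>z. eval (atomic_diagram (inv_image E p')) s [z, x, y] 1)"
      have bij: "bij p'" and p'_q: "\<And>i. i < N \<Longrightarrow> p' i = q i"
        using p' by (auto simp: extends_def)
      have "(p' i, p' j) \<in> E \<longleftrightarrow> (p i, p j) \<in> E" if ij: "i < N" "j < N" for i j
      proof -
        have CE: "(p i, x) \<in> E \<longleftrightarrow> x \<in> C" if "p i \<in> C" for x i
          using quotient_mem_iff[OF E C(1) that] .
        have DE: "(x, y) \<in> E \<longleftrightarrow> y \<in> D" if "x \<in> D" for x y
          using quotient_mem_iff[OF E D(1) that] .
        have sym: "(x, y) \<in> E \<longleftrightarrow> (y, x) \<in> E" for x y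
          using E by (meson equivE symE)
        show ?thesis
          unfolding p'_q[OF ij(1)] p'_q[OF ij(2)] q_def
          using D_p[OF ij(1)] D_p[OF ij(2)] \<sigma>_D CE DE sym by (smt (verit))
      qed
      \<comment> \<open>Pair codes bound their components, so oracle positions below
        \<open>n0\<close> concern only points below \<open>N\<close>.\<close>
      then have "atomic_diagram (inv_image E p') i = atomic_diagram (inv_image E p) i" if "i < n0" for i
      proof -
        obtain x y where xy: "i = prod_encode (x, y)" by (metis prod_decode_inverse surj_pair)
        then have "x < N" "y < N"
          using that le_prod_encode_1[of x y] le_prod_encode_2[of y x] by (auto simp: N_def)
        then show ?thesis
          using \<open>\<And>j i. i < N \<Longrightarrow> j < N \<Longrightarrow> (p' i, p' j) \<in> E \<longleftrightarrow> (p i, p j) \<in> E\<close> xy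
          by (simp add: atomic_diagram_def)
      qed
      \<comment> \<open>The preserved computation forces the value \<open>y\<close>, whose class has
        the size of \<open>C\<close>, although the class of \<open>a\<close> now has the size of
        \<open>D\<close>.\<close>
      then have "f a = y" using n0 graph by blast
      have "p' a = \<sigma> c" using p'_q[of a] pa c by (simp add: N_def q_def)
      then have "D = E `` {p' a}" using quotient_eq_class[OF E D(1) \<sigma>_D[OF c]] by simp
      also have "\<dots> \<approx> inv_image E p' `` {a}"
        using isomorphism_class_eqpoll[OF isomorphism_inv_image[OF bij]] eqpoll_sym by blast
      also have "\<dots> \<approx> E `` {y}"
        using isomorphism_class_eqpoll[OF f] \<open>f a = y\<close> by blast
      also have "\<dots> \<approx> C" using y eqpoll_sym by blast
      finally have "D \<approx> C" .
      then have "finite D" "card D = card C"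
        using C(2) eqpoll_finite_iff eqpoll_iff_card by blast+
      then show False using D(3) by simp
    qed
    then show ?thesis using dist list by metis
  next
    case False
    have "defeats E s p" if p: "extends p (ps @ [c])" for p
      unfolding defeats_def
    proof (intro notI, elim exE conjE)
      fix f
      assume f: "isomorphism (inv_image E p) E f"
        and graph: "\<forall>x y. f x = y \<longleftrightarrow> (\<exists>z. eval (atomic_diagram (inv_image E p)) s [z, x, y] 1)"
      have "p a = c" and bij: "bij p" using p by (auto simp: extends_def a_def nth_append)
      then have "C = E `` {p a}" using quotient_eq_class[OF E C(1) c] by simp
      also have "\<dots> \<approx> inv_image E p `` {a}"
        using isomorphism_class_eqpoll[OF isomorphism_inv_image[OF bij]] eqpoll_sym by blast
      also have "\<dots> \<approx> E `` {f a}"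
        using isomorphism_class_eqpoll[OF f] by blast
      finally show False using False p graph by blast
    qed
    moreover have "distinct (ps @ [c])" using ps c C(3) by auto
    ultimately show ?thesis by blast
  qed
qed

instance scheme :: countable
  by countable_datatype

text \<open>Stage \<open>n\<close> first lists \<open>n\<close>, which makes the limit surjective,
  and then defeats the \<open>n\<close>-th scheme; distinctness of the lists makes the limit
  injective.\<close>

lemma exists_defeating_permutation:
  assumes step: "\<And>ps s. distinct ps \<Longrightarrow>
    \<exists>qs. distinct (ps @ qs) \<and> (\<forall>p. extends p (ps @ qs) \<longrightarrow> defeats E s p)"
  obtains p where "bij p" and "\<And>s. defeats E s p"
proof -
  let ?Q = "\<lambda>n l l'. (\<exists>qs. l' = l @ qs) \<and> n \<in> set l' \<and>
    (\<forall>p. extends p l' \<longrightarrow> defeats E (from_nat n) p)"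
  have "\<exists>L. \<forall>n. distinct (L n) \<and> ?Q n (L n) (L (Suc n))"
  proof (rule dependent_nat_choice)
    show "\<exists>l::nat list. distinct l" by (rule exI[of _ "[]"]) simp
  next
    fix l :: "nat list" and n
    assume l: "distinct l"
    define l1 where "l1 = (if n \<in> set l then l else l @ [n])"
    have l1: "distinct l1" "n \<in> set l1" "\<exists>qs. l1 = l @ qs"
      using l by (auto simp: l1_def)
    obtain qs where "distinct (l1 @ qs)" "\<forall>p. extends p (l1 @ qs) \<longrightarrow> defeats E (from_nat n) p"
      using step[OF l1(1)] by blast
    then show "\<exists>l'. distinct l' \<and> ?Q n l l'"
      using l1 by (intro exI[of _ "l1 @ qs"]) auto
  qed
  then obtain L where L: "\<And>n. distinct (L n)" "\<And>n. \<exists>qs. L (Suc n) = L n @ qs"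
    "\<And>n. n \<in> set (L (Suc n))" "\<And>n p. extends p (L (Suc n)) \<Longrightarrow> defeats E (from_nat n) p"
    by blast
  have prefix: "\<exists>qs. L n = L m @ qs" if "m \<le> n" for m n
    using that
  proof (induction rule: dec_induct)
    case (step n)
    then show ?case using L(2)[of n] by auto
  qed simp
  have "{..n} \<subseteq> set (L (Suc n))" for n
  proof
    fix m assume "m \<in> {..n}"
    then show "m \<in> set (L (Suc n))"
      using L(3)[of m] prefix[of "Suc m" "Suc n"] by auto
  qed
  then have long: "n < length (L (Suc n))" for n
    using card_mono[of "set (L (Suc n))" "{..n}"] distinct_card[OF L(1), of "Suc n"] by simp
  \<comment> \<open>\<open>L (Suc i)\<close> contains the \<open>i + 1\<close> numbers up to
    \<open>i\<close>, so it has an entry at position \<open>i\<close>.\<close>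
  define p where "p i = L (Suc i) ! i" for i
  have p: "p i = L n ! i" if i: "i < length (L n)" for i n
  proof (cases "n \<le> Suc i")
    case True
    then show ?thesis using prefix[OF True] i by (auto simp: p_def nth_append)
  next
    case False
    then have "Suc i \<le> n" by simp
    then show ?thesis using prefix[of "Suc i" n] long[of i] by (auto simp: p_def nth_append)
  qed
  have "inj p"
  proof (rule injI)
    fix i j assume "p i = p j"
    let ?n = "Suc (max i j)"
    have "i < length (L ?n)" "j < length (L ?n)" using long[of "max i j"] by auto
    then show "i = j"
      using \<open>p i = p j\<close> L(1)[of ?n] p[of i ?n] p[of j ?n] by (simp add: nth_eq_iff_index_eq)
  qed
  moreover have "surj p"
    unfolding surj_def using L(3) p by (metis in_set_conv_nth)
  ultimately have "bij p" by (simp add: bij_def)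
  moreover have "defeats E s p" for s
  proof -
    have "extends p (L (Suc (to_nat s)))"
      using \<open>bij p\<close> p by (simp add: extends_def)
    from L(4)[OF this] show ?thesis by simp
  qed
  ultimately show thesis by (rule that)
qed

lemma not_rel_Delta01_categorical_if_defeats:
  assumes "bij p" and defeats: "\<And>s. defeats E s p"
  shows "\<not> rel_Delta01_categorical E"
proof
  assume "rel_Delta01_categorical E"
  moreover have "isomorphic (inv_image E p) E"
    using isomorphism_inv_image[OF assms(1)] unfolding isomorphic_def by blast
  ultimately obtain f where f: "isomorphism (inv_image E p) E f"
    and "Delta01_fun_in (atomic_diagram (inv_image E p)) f"
    unfolding rel_Delta01_categorical_def by blast
  then obtain S where "computable_in (atomic_diagram (inv_image E p)) (Suc 2) (\<lambda>xs. of_bool (S xs))"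
    and S: "\<And>xs. length xs = 2 \<Longrightarrow> f (xs ! 0) = xs ! 1 \<longleftrightarrow> (\<exists>z. S (z # xs))"
    unfolding Delta01_fun_in_def Delta01_in_def Sigma01_in_def by blast
  then obtain s where s: "\<And>xs. length xs = Suc 2 \<Longrightarrow>
      eval (atomic_diagram (inv_image E p)) s xs (of_bool (S xs))"
    unfolding computable_in_def by blast
  \<comment> \<open>Determinism excludes the output 1 when \<open>S\<close> fails, which brings the
    graph into the form used by \<open>defeats\<close>.\<close>
  have "S [z, x, y] \<longleftrightarrow> eval (atomic_diagram (inv_image E p)) s [z, x, y] 1" for x y z
    using s[of "[z, x, y]"] eval_deterministic[of _ s "[z, x, y]" "of_bool (S [z, x, y])" 1]
    by (cases "S [z, x, y]") auto
  moreover have "f x = y \<longleftrightarrow> (\<exists>z. S [z, x, y])" for x y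
    using S[of "[x, y]"] by simp
  ultimately show False
    using defeats[of s] f unfolding defeats_def by blast
qed

lemma finite_classes_meeting:
  assumes "equiv UNIV E" and "finite R"
  shows "finite {X \<in> UNIV // E. X \<inter> R \<noteq> {}}"
proof (rule finite_subset)
  show "{X \<in> UNIV // E. X \<inter> R \<noteq> {}} \<subseteq> (\<lambda>x. E `` {x}) ` R"
    using quotient_eq_class[OF assms(1)] by blast
qed (use assms(2) in simp)

text \<open>If the diagonalisation cannot be run, there is a finite \<open>R\<close> such that the
  size of any finite class off \<open>R\<close> bounds all class sizes off a further finite set. For
  a class of least size off \<open>R\<close> this upper bound meets the lower one, so the size is
  constant off a finite set; if no finite class is off \<open>R\<close>, only finitely many are
  finite.\<close>

lemma class_sizes_if_rel_Delta01_categorical: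
  assumes E: "equiv UNIV E" and rel: "rel_Delta01_categorical E"
  shows "finite {X \<in> UNIV // E. finite X} \<or>
    (\<exists>k. finite {X \<in> UNIV // E. \<not> (finite X \<and> card X = k)})"
proof -
  define Q where "Q R C \<longleftrightarrow> C \<in> UNIV // E \<and> finite C \<and> C \<inter> R = {}" for R C
  define W where "W C R' \<longleftrightarrow>
    (\<exists>C'\<in>UNIV // E. C' \<inter> R' = {} \<and> (finite C' \<longrightarrow> card C < card C'))" for C R' :: "nat set"
  have "\<not> (\<forall>R. finite R \<longrightarrow> (\<exists>C. Q R C \<and> (\<forall>R'. finite R' \<longrightarrow> W C R')))"
  proof
    assume large: "\<forall>R. finite R \<longrightarrow> (\<exists>C. Q R C \<and> (\<forall>R'. finite R' \<longrightarrow> W C R'))"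
    have "\<exists>qs. distinct (ps @ qs) \<and> (\<forall>p. extends p (ps @ qs) \<longrightarrow> defeats E s p)"
      if "distinct ps" for ps s
    proof (rule defeats_extension[OF E that])
      fix R :: "nat set"
      assume "finite R"
      then obtain C where "Q R C" "\<forall>R'. finite R' \<longrightarrow> W C R'"
        using large by blast
      then show "\<exists>C\<in>UNIV // E. finite C \<and> C \<inter> R = {} \<and> (\<forall>R'. finite R' \<longrightarrow>
          (\<exists>C'\<in>UNIV // E. C' \<inter> R' = {} \<and> (finite C' \<longrightarrow> card C < card C')))"
        unfolding Q_def W_def by (intro bexI[of _ C]) simp_all
    qed
    then obtain p where "bij p" "\<And>s. defeats E s p"
      using exists_defeating_permutation by blast
    then show False
      using not_rel_Delta01_categorical_if_defeats rel by blast
  qed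
  then have "\<exists>R. finite R \<and> (\<forall>C. Q R C \<longrightarrow> (\<exists>R'. finite R' \<and> \<not> W C R'))"
    by simp
  then obtain R where R: "finite R"
    and bounded: "\<And>C. Q R C \<Longrightarrow> \<exists>R'. finite R' \<and> \<not> W C R'"
    by (elim exE conjE) simp
  show ?thesis
  proof (cases "\<exists>C\<in>UNIV // E. finite C \<and> C \<inter> R = {}")
    case False
    then have "{X \<in> UNIV // E. finite X} \<subseteq> {X \<in> UNIV // E. X \<inter> R \<noteq> {}}" by blast
    then show ?thesis using finite_classes_meeting[OF E R] finite_subset by blast
  next
    case True
    then obtain C where C: "C \<in> UNIV // E" "finite C" "C \<inter> R = {}"
      and least: "\<And>X. X \<in> UNIV // E \<Longrightarrow> finite X \<Longrightarrow> X \<inter> R = {} \<Longrightarrow> card C \<le> card X"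
      using ex_has_least_nat[of "\<lambda>C. C \<in> UNIV // E \<and> finite C \<and> C \<inter> R = {}" _ card] by metis
    obtain R' where R': "finite R'"
      "\<And>X. X \<in> UNIV // E \<Longrightarrow> X \<inter> R' = {} \<Longrightarrow> finite X \<and> \<not> card C < card X"
      using bounded[of C] C unfolding Q_def W_def by auto
    have "{X \<in> UNIV // E. \<not> (finite X \<and> card X = card C)} \<subseteq> {X \<in> UNIV // E. X \<inter> (R \<union> R') \<noteq> {}}"
    proof
      fix X assume "X \<in> {X \<in> UNIV // E. \<not> (finite X \<and> card X = card C)}"
      then have X: "X \<in> UNIV // E" "\<not> (finite X \<and> card X = card C)" by auto
      have "X \<inter> (R \<union> R') \<noteq> {}"
      proof
        assume "X \<inter> (R \<union> R') = {}"
        then have "X \<inter> R = {}" "X \<inter> R' = {}" by auto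
        then show False using R'(2)[OF X(1)] least[OF X(1)] X(2) by auto
      qed
      with X(1) show "X \<in> {X \<in> UNIV // E. X \<inter> (R \<union> R') \<noteq> {}}" by blast
    qed
    moreover have "finite {X \<in> UNIV // E. X \<inter> (R \<union> R') \<noteq> {}}"
      using finite_classes_meeting[OF E] R R'(1) by simp
    ultimately have "finite {X \<in> UNIV // E. \<not> (finite X \<and> card X = card C)}"
      by (rule finite_subset)
    then show ?thesis by blast
  qed
qed

section \<open>Fast and slow copies\<close>

lemma primrec_fun_iff: "primrec_fun f \<longleftrightarrow> primrec_in no_oracle (Suc 0) (\<lambda>xs. f (xs ! 0))"
  by (simp add: primrec_fun_def)

lemma pr_PR_le: "f \<le>\<^sub>P\<^sub>R g \<Longrightarrow> primrec_in g n F \<Longrightarrow> primrec_in g n (\<lambda>xs. f (F xs))"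
  unfolding PR_le_iff by (rule pr_comp1)

lemma pr_primrec_fun: "primrec_fun f \<Longrightarrow> primrec_in g n F \<Longrightarrow> primrec_in g n (\<lambda>xs. f (F xs))"
  unfolding primrec_fun_iff using primrec_in_no_oracle pr_comp1 by blast

lemma pr_graph:
  assumes "primrec_in no_oracle 2 (\<lambda>xs. of_bool (t (xs ! 0) = xs ! 1))"
    and "primrec_in g n F" and "primrec_in g n G"
  shows "primrec_in g n (\<lambda>xs. of_bool (t (F xs) = G xs))"
  using pr_comp2[of g "\<lambda>x y. of_bool (t x = y)" n F G] primrec_in_no_oracle[OF assms(1), of g] assms
  by (simp add: numeral_2_eq_2)

text \<open>Copies are presented by labellings: a primitive recursive labelling is punctual at once,
  and isomorphism reduces to comparing fibre sizes.\<close>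

definition fibre_rel :: "(nat \<Rightarrow> 'a) \<Rightarrow> nat rel" where
  "fibre_rel c = {(x, y). c x = c y}"

lemma fibre_rel_class: "fibre_rel c `` {x} = c -` {c x}"
  by (auto simp: fibre_rel_def)

lemma punctual_fibre_rel:
  assumes "primrec_fun c"
  shows "punctual (fibre_rel c)"
proof -
  have "primrec_in no_oracle 2 (\<lambda>xs. of_bool (c (xs ! 0) = c (xs ! 1)))"
    by (intro pr_eq pr_primrec_fun[OF assms] pr_nth) simp_all
  then show ?thesis by (simp add: punctual_def fibre_rel_def)
qed

lemma fibre_rel_isomorphicI:
  assumes "\<And>j. L -` {j} \<approx> c -` {j}"
  shows "isomorphic (fibre_rel L) (fibre_rel c)"
proof -
  obtain b where b: "\<And>j. bij_betw (b j) (L -` {j}) (c -` {j})"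
    using assms unfolding eqpoll_def by metis
  define f where "f x = b (L x) x" for x
  have cf: "c (f x) = L x" for x
    using bij_betwE[OF b[of "L x"]] by (simp add: f_def)
  have "inj f"
  proof (rule injI)
    fix x y assume *: "f x = f y"
    then have "L x = L y" using cf by metis
    then show "x = y"
      using * bij_betw_imp_inj_on[OF b[of "L x"]] by (auto simp: f_def inj_on_def)
  qed
  moreover have "surj f"
    unfolding surj_def
  proof
    fix z
    have "z \<in> b (c z) ` (L -` {c z})"
      using b[of "c z"] by (simp add: bij_betw_def)
    then obtain x where "z = b (c z) x" "L x = c z" by auto
    then show "\<exists>x. z = f x" unfolding f_def by metis
  qed
  ultimately have "isomorphism (fibre_rel L) (fibre_rel c) f"
    by (simp add: isomorphism_def fibre_rel_def bij_def cf)
  then show ?thesis unfolding isomorphic_def by blast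
qed

text \<open>\<open>E\<close> is itself given by a labelling, namely \<open>l\<close> of the class of
  a point. Numbers outside \<open>range c\<close> have empty fibres on both sides.\<close>

lemma fibre_rel_isomorphic_quotient:
  assumes E: "equiv UNIV E" and l: "bij_betw l (UNIV // E) (range c)"
    and size: "\<And>X. X \<in> UNIV // E \<Longrightarrow> X \<approx> c -` {l X}"
  shows "isomorphic (fibre_rel c) E"
proof -
  have Q: "E `` {x} \<in> UNIV // E" for x by (simp add: quotientI)
  have inj: "l X = l Y \<longleftrightarrow> X = Y" if "X \<in> UNIV // E" "Y \<in> UNIV // E" for X Y
    using l that by (auto simp: bij_betw_def inj_on_def)
  have "fibre_rel (\<lambda>x. l (E `` {x})) = E"
    unfolding fibre_rel_def using inj[OF Q Q] eq_equiv_class_iff[OF E] by auto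
  moreover have "isomorphic (fibre_rel (\<lambda>x. l (E `` {x}))) (fibre_rel c)"
  proof (rule fibre_rel_isomorphicI)
    fix j
    show "(\<lambda>x. l (E `` {x})) -` {j} \<approx> c -` {j}"
    proof (cases "j \<in> range c")
      case True
      then obtain X where X: "X \<in> UNIV // E" "j = l X"
        using l by (auto simp: bij_betw_def)
      have "l (E `` {x}) = j \<longleftrightarrow> x \<in> X" for x
        using inj[OF Q X(1)] X quotient_eq_class[OF E X(1)] E
        by (metis Image_singleton_iff UNIV_I equiv_class_self)
      then have "(\<lambda>x. l (E `` {x})) -` {j} = X" by auto
      then show ?thesis using size X by simp
    next
      case False
      then have "(\<lambda>x. l (E `` {x})) -` {j} = {}" "c -` {j} = {}"
        using l Q by (auto simp: bij_betw_def)
      then show ?thesis by simp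
    qed
  qed
  ultimately show ?thesis using isomorphic_sym by metis
qed

lemma infinite_nat_sets_eqpoll:
  fixes A B :: "nat set"
  assumes "infinite A" and "infinite B"
  shows "A \<approx> B"
proof -
  have "A \<approx> (UNIV :: nat set)" if "infinite A" for A :: "nat set"
    using to_nat_on_infinite[OF _ that] unfolding eqpoll_def by auto
  then show ?thesis using assms eqpoll_sym eqpoll_trans by metis
qed

text \<open>The labels of the finitely many exceptional points are made odd to keep them apart.\<close>

definition glue :: "nat \<Rightarrow> (nat \<Rightarrow> nat) \<Rightarrow> (nat \<Rightarrow> nat) \<Rightarrow> nat \<Rightarrow> nat" where
  "glue N w c x = (if x < N then 2 * w x + 1 else 2 * c (x - N))"

lemma primrec_fun_glue:
  assumes "primrec_fun c"
  shows "primrec_fun (glue N w c)"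
  unfolding primrec_fun_iff glue_def
  by (intro pr_finite_modification pr_mult pr_const pr_primrec_fun[OF assms] pr_diff pr_nth) simp

lemma glue_vimage_even: "glue N w c -` {2 * j} = (\<lambda>x. x + N) ` (c -` {j})"
proof (intro set_eqI iffI)
  fix x assume "x \<in> glue N w c -` {2 * j}"
  then have "2 * w x + 1 = 2 * j \<or> (N \<le> x \<and> c (x - N) = j)"
    by (auto simp: glue_def split: if_splits)
  then have "N \<le> x" "c (x - N) = j" by presburger+
  then show "x \<in> (\<lambda>x. x + N) ` (c -` {j})" by (intro image_eqI[of _ _ "x - N"]) auto
qed (auto simp: glue_def)

lemma glue_vimage_odd: "glue N w c -` {2 * j + 1} = {x. x < N \<and> w x = j}"
proof (intro set_eqI iffI)
  fix x assume "x \<in> glue N w c -` {2 * j + 1}"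
  then have "(x < N \<and> w x = j) \<or> 2 * c (x - N) = 2 * j + 1"
    by (auto simp: glue_def split: if_splits)
  then show "x \<in> {x. x < N \<and> w x = j}" by simp presburger
qed (auto simp: glue_def)

lemma range_glue: "range (glue N w c) = (\<lambda>x. 2 * w x + 1) ` {..<N} \<union> (\<lambda>j. 2 * j) ` range c"
proof (intro set_eqI iffI)
  fix y assume "y \<in> (\<lambda>x. 2 * w x + 1) ` {..<N} \<union> (\<lambda>j. 2 * j) ` range c"
  then consider x where "x < N" "y = 2 * w x + 1" | x where "y = 2 * c x" by auto
  then show "y \<in> range (glue N w c)"
  proof cases
    case 1
    then show ?thesis by (intro image_eqI[of _ _ x]) (auto simp: glue_def)
  next
    case 2
    then show ?thesis by (intro image_eqI[of _ _ "x + N"]) (auto simp: glue_def)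
  qed
qed (auto simp: glue_def)

text \<open>The points of the classes in \<open>\<D>\<close> are tabulated on an initial segment and
  all others are shifted past it. Therefore finitely many finite classes never obstruct a primitive
  recursive labelling.\<close>

lemma isomorphic_glue:
  assumes E: "equiv UNIV E" and fin: "finite \<D>" "\<And>X. X \<in> \<D> \<Longrightarrow> X \<in> UNIV // E \<and> finite X"
    and l: "bij_betw l (UNIV // E - \<D>) (range c)"
    and size: "\<And>X. X \<in> UNIV // E - \<D> \<Longrightarrow> X \<approx> c -` {l X}"
  shows "\<exists>N w. isomorphic (fibre_rel (glue N w c)) E"
proof -
  have "finite (\<Union>\<D>)" using fin by blast
  then obtain h where h: "bij_betw h {0..<card (\<Union>\<D>)} (\<Union>\<D>)"
    using ex_bij_betw_nat_finite by blast
  define N where "N = card (\<Union>\<D>)"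
  \<comment> \<open>The least element serves as a number naming the class, so that \<open>w\<close>
    is equal exactly on equivalent points.\<close>
  define m where "m X = (LEAST x. x \<in> X)" for X :: "nat set"
  define w where "w i = m (E `` {h i})" for i
  define l' where "l' X = (if X \<in> \<D> then 2 * m X + 1 else 2 * l X)" for X
  have m_mem: "m X \<in> X" if "X \<in> UNIV // E" for X
  proof -
    have "\<exists>x. x \<in> X" using that E in_quotient_imp_non_empty by blast
    then show ?thesis unfolding m_def by (rule LeastI_ex)
  qed
  have m_inj: "X = Y" if "X \<in> UNIV // E" "Y \<in> UNIV // E" "m X = m Y" for X Y
    using quotient_eq_class[OF E that(1) m_mem[OF that(1)]]
      quotient_eq_class[OF E that(2) m_mem[OF that(2)]] that(3) by simp
  have h_D: "h i \<in> \<Union>\<D>" if "i < N" for i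
    using bij_betwE[OF h] that by (auto simp: N_def)
  have hE: "E `` {h i} \<in> \<D>" if i: "i < N" for i
  proof -
    obtain X where X: "X \<in> \<D>" "h i \<in> X" using h_D[OF i] by blast
    then have "X = E `` {h i}" using quotient_eq_class[OF E] fin(2) by blast
    with X(1) show ?thesis by simp
  qed
  have hX: "\<exists>i<N. h i = x" if "x \<in> \<Union>\<D>" for x
  proof -
    have "x \<in> h ` {0..<N}" using bij_betw_imp_surj_on[OF h] that by (simp add: N_def)
    then show ?thesis by auto
  qed
  have "bij_betw l' \<D> ((\<lambda>x. 2 * w x + 1) ` {..<N})"
  proof (rule bij_betw_imageI)
    show "inj_on l' \<D>"
      using m_inj fin(2) by (auto simp: inj_on_def l'_def)
    show "l' ` \<D> = (\<lambda>x. 2 * w x + 1) ` {..<N}"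
    proof (intro set_eqI iffI)
      fix y assume "y \<in> l' ` \<D>"
      then obtain X where X: "X \<in> \<D>" "y = 2 * m X + 1" by (auto simp: l'_def)
      then have mX: "m X \<in> X" using m_mem fin(2) by blast
      then obtain i where i: "i < N" "h i = m X" using hX X(1) by blast
      then have "w i = m X"
        using quotient_eq_class[OF E _ mX] X(1) fin(2) by (simp add: w_def)
      then show "y \<in> (\<lambda>x. 2 * w x + 1) ` {..<N}"
        using i(1) X(2) by (intro image_eqI[of _ _ i]) simp_all
    next
      fix y assume "y \<in> (\<lambda>x. 2 * w x + 1) ` {..<N}"
      then obtain i where "i < N" "y = 2 * w i + 1" by auto
      then show "y \<in> l' ` \<D>"
        using hE[of i] by (intro image_eqI[of _ _ "E `` {h i}"]) (auto simp: l'_def w_def)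
    qed
  qed
  moreover have "bij_betw l' (UNIV // E - \<D>) ((\<lambda>j. 2 * j) ` range c)"
  proof (rule bij_betw_imageI)
    show "inj_on l' (UNIV // E - \<D>)"
      using bij_betw_imp_inj_on[OF l] by (auto simp: inj_on_def l'_def)
    have "l' ` (UNIV // E - \<D>) = (\<lambda>j. 2 * j) ` (l ` (UNIV // E - \<D>))"
      unfolding image_image by (intro image_cong) (auto simp: l'_def)
    then show "l' ` (UNIV // E - \<D>) = (\<lambda>j. 2 * j) ` range c"
      using bij_betw_imp_surj_on[OF l] by simp
  qed
  moreover have "((\<lambda>x. 2 * w x + 1) ` {..<N}) \<inter> ((\<lambda>j. 2 * j) ` range c) = {}"
    by (auto, presburger)
  ultimately have "bij_betw l' (\<D> \<union> (UNIV // E - \<D>)) (range (glue N w c))"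
    unfolding range_glue by (rule bij_betw_combine)
  moreover have "\<D> \<union> (UNIV // E - \<D>) = UNIV // E" using fin(2) by blast
  ultimately have "bij_betw l' (UNIV // E) (range (glue N w c))" by simp
  moreover have "X \<approx> glue N w c -` {l' X}" if X: "X \<in> UNIV // E" for X
  proof (cases "X \<in> \<D>")
    case True
    have "w i = m X \<longleftrightarrow> h i \<in> X" if "i < N" for i
    proof
      assume "w i = m X"
      then have "E `` {h i} = X"
        using m_inj[OF _ X] fin(2) hE[OF that] by (auto simp: w_def)
      then show "h i \<in> X" using equiv_class_self[OF E] by auto
    qed (use quotient_eq_class[OF E X] in \<open>simp add: w_def\<close>)
    then have "glue N w c -` {l' X} = {i. i < N \<and> h i \<in> X}"
      using True by (auto simp: l'_def glue_vimage_odd simp del: One_nat_def)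
    moreover have "h ` {i. i < N \<and> h i \<in> X} = X"
      using hX True by fastforce
    moreover have "inj_on h {i. i < N \<and> h i \<in> X}"
      using bij_betw_imp_inj_on[OF h] by (auto simp: N_def inj_on_def)
    ultimately show ?thesis
      using inj_on_image_eqpoll_self by metis
  next
    case False
    then have "X \<approx> c -` {l X}" using size X by blast
    also have "\<dots> \<approx> (\<lambda>x. x + N) ` (c -` {l X})"
      by (intro eqpoll_sym[OF inj_on_image_eqpoll_self]) (auto simp: inj_on_def)
    finally show ?thesis using False by (simp add: l'_def glue_vimage_even)
  qed
  ultimately show ?thesis using fibre_rel_isomorphic_quotient[OF E] by blast
qed

section \<open>Lower bounds from isomorphisms between copies\<close>

lemma PrCat_isomorphism:
  assumes d: "d \<in> PrCat E" "g \<in> d"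
    and "punctual B" "isomorphic B E" and "punctual C" "isomorphic C E"
  obtains G where "isomorphism B C G" and "G \<le>\<^sub>P\<^sub>R g" and "inv G \<le>\<^sub>P\<^sub>R g"
proof -
  have "d \<in> PR_degrees" using d by (simp add: PrCat_def)
  then have le: "f \<preceq>\<^sub>P\<^sub>R d \<longleftrightarrow> f \<le>\<^sub>P\<^sub>R g" for f
    using PR_le_degree_iff d(2) by blast
  have iso: "\<exists>f. isomorphism E D f \<and> f \<le>\<^sub>P\<^sub>R g \<and> inv f \<le>\<^sub>P\<^sub>R g"
    if "punctual D" "isomorphic D E" for D
    using d(1) that by (simp add: PrCat_def le)
  obtain u where u: "isomorphism E B u" "u \<le>\<^sub>P\<^sub>R g" "inv u \<le>\<^sub>P\<^sub>R g"
    using iso[OF assms(3,4)] by blast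
  obtain v where v: "isomorphism E C v" "v \<le>\<^sub>P\<^sub>R g" "inv v \<le>\<^sub>P\<^sub>R g"
    using iso[OF assms(5,6)] by blast
  have bij: "bij u" "bij v" using u v by (auto simp: isomorphism_def)
  have comp: "p \<circ> q \<le>\<^sub>P\<^sub>R g" if "p \<le>\<^sub>P\<^sub>R g" "q \<le>\<^sub>P\<^sub>R g" for p q
    unfolding PR_le_iff comp_def by (intro pr_PR_le[OF that(1)] pr_PR_le[OF that(2)] pr_nth) simp
  show thesis
  proof (rule that)
    \<comment> \<open>The maps supplied start in \<open>E\<close>, so the way from \<open>B\<close>
      to \<open>C\<close> leads back through \<open>inv u\<close>.\<close>
    show "isomorphism B C (v \<circ> inv u)"
      using isomorphism_comp[OF isomorphism_inv[OF u(1)] v(1)] .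
    show "v \<circ> inv u \<le>\<^sub>P\<^sub>R g" using comp u v by blast
    have "inv (v \<circ> inv u) = u \<circ> inv v"
      using bij by (simp add: o_inv_distrib bij_imp_bij_inv inv_inv_eq)
    then show "inv (v \<circ> inv u) \<le>\<^sub>P\<^sub>R g" using comp u v by simp
  qed
qed

text \<open>
  In the slow copy almost every point is put into the class of 0, and the code of
  \<open>(n, t n)\<close> takes the place of \<open>n\<close>. Infinitely many quickly found points
  avoid the class that corresponds to the class of 0 in the slow copy, so they are
  mapped to such codes.
\<close>

lemma infinite_filler_lower_bound:
  assumes d: "d \<in> PrCat E" "g \<in> d" and f: "Delta01_fun_in no_oracle f"
    and c: "primrec_fun c" "isomorphic (fibre_rel c) E" and inf: "infinite (c -` {0 :: nat})"
    and avoid: "\<And>j. infinite (c -` {j}) \<Longrightarrow> \<exists>e. primrec_fun e \<and> inj e \<and> (\<forall>i. c (e i) \<noteq> j)"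
  shows "f \<le>\<^sub>P\<^sub>R g"
proof -
  obtain t where t: "mono t"
    "primrec_in no_oracle 2 (\<lambda>xs. of_bool (t (xs ! 0) = xs ! 1))"
    "\<And>g h. h \<le>\<^sub>P\<^sub>R g \<Longrightarrow> (\<And>n. t n \<le> h n) \<Longrightarrow> f \<le>\<^sub>P\<^sub>R g"
    using Delta01_time_function[OF f] by blast
  \<comment> \<open>Only the graph of \<open>t\<close> is tested and \<open>t\<close> is never
    evaluated, so the labelling stays primitive recursive.\<close>
  define s where "s x = (if t (fst (prod_decode x)) = snd (prod_decode x)
    then c (fst (prod_decode x)) else 0)" for x
  have s_prim: "primrec_fun s"
    unfolding primrec_fun_iff s_def
    by (intro pr_If pr_graph[OF t(2)] pr_fst_decode pr_snd_decode pr_primrec_fun[OF c(1)] pr_const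
        pr_nth) simp_all
  define r where "r n = prod_encode (n, t n)" for n
  have r_inj: "inj r" by (auto simp: inj_def r_def inj_eq[OF inj_prod_encode])
  have s_r: "s (r n) = c n" for n by (simp add: s_def r_def)
  have s_0: "s x = 0" if "x \<notin> range r" for x
  proof -
    have "x = r (fst (prod_decode x))" if "t (fst (prod_decode x)) = snd (prod_decode x)"
      using that by (simp add: r_def)
    then show ?thesis using that by (auto simp: s_def)
  qed
  have inf_s: "infinite (s -` {0})"
  proof -
    have "r ` (c -` {0}) \<subseteq> s -` {0}" using s_r by auto
    then show ?thesis
      using inf r_inj by (metis finite_imageD finite_subset inj_on_subset subset_UNIV)
  qed
  have "isomorphic (fibre_rel s) (fibre_rel c)"
  proof (rule isomorphic_sym[OF fibre_rel_isomorphicI])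
    fix j
    show "c -` {j} \<approx> s -` {j}"
    proof (cases "j = 0")
      case True
      then show ?thesis using infinite_nat_sets_eqpoll[OF inf inf_s] by simp
    next
      case False
      then have "s -` {j} = r ` (c -` {j})" using s_r s_0 by force
      then show ?thesis
        using r_inj by (simp add: eqpoll_sym inj_on_image_eqpoll_self inj_on_subset)
    qed
  qed
  then have "isomorphic (fibre_rel s) E" using c(2) isomorphic_trans by blast
  then obtain G where G: "isomorphism (fibre_rel c) (fibre_rel s) G" "G \<le>\<^sub>P\<^sub>R g"
    using PrCat_isomorphism[OF d punctual_fibre_rel[OF c(1)] c(2) punctual_fibre_rel[OF s_prim]] by blast
  have "bij G" and G_iff: "\<And>x y. c x = c y \<longleftrightarrow> s (G x) = s (G y)"
    using G(1) by (auto simp: isomorphism_def fibre_rel_def)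
  \<comment> \<open>\<open>y\<close> represents the class that \<open>G\<close> sends to the filler.
    It depends on \<open>G\<close>, but only its label enters the choice of
    \<open>e\<close>.\<close>
  obtain z where "s z = 0" using inf_s by (metis finite.emptyI vimage_singleton_eq equals0I)
  then obtain y where y: "s (G y) = 0" using \<open>bij G\<close> by (metis bij_pointE)
  have "c -` {c y} \<approx> s -` {0}"
    using isomorphism_class_eqpoll[OF G(1), of y] y by (simp add: fibre_rel_class)
  then have "infinite (c -` {c y})" using inf_s eqpoll_finite_iff by blast
  then obtain e where e: "primrec_fun e" "inj e" "\<And>i. c (e i) \<noteq> c y"
    using avoid by blast
  have "G (e i) \<in> range r" for i
    using e(3)[of i] G_iff[of "e i" y] y s_0 by metis
  then have "\<forall>i. \<exists>n. G (e i) = r n" by blast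
  then obtain q where q: "\<And>i. G (e i) = r (q i)" by metis
  have "inj q"
  proof (rule injI)
    fix i j assume "q i = q j"
    then have "G (e i) = G (e j)" using q by simp
    then show "i = j" using e(2) \<open>bij G\<close> by (simp add: bij_is_inj inj_eq)
  qed
  \<comment> \<open>Among the \<open>n + 1\<close> distinct numbers \<open>q i\<close> one is at
    least \<open>n\<close>. Which one is unknown, so all candidates \<open>G (e i)\<close> are
    summed.\<close>
  have "t n \<le> (\<Sum>i<Suc n. G (e i))" for n
  proof -
    have "\<not> q ` {..<Suc n} \<subseteq> {..<n}"
      using \<open>inj q\<close> card_mono[of "{..<n}" "q ` {..<Suc n}"]
      by (auto simp: card_image inj_on_subset)
    then obtain i where i: "i < Suc n" "n \<le> q i" by force
    have "t n \<le> t (q i)" using t(1) i(2) by (rule monoD)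
    also have "\<dots> \<le> G (e i)" unfolding q r_def by (rule le_prod_encode_2)
    also have "\<dots> \<le> (\<Sum>i<Suc n. G (e i))"
      using i(1) by (intro member_le_sum) auto
    finally show ?thesis .
  qed
  moreover have "(\<lambda>n. \<Sum>i<Suc n. G (e i)) \<le>\<^sub>P\<^sub>R g"
    unfolding PR_le_iff
    by (intro pr_sum pr_Suc pr_PR_le[OF G(2)] pr_primrec_fun[OF e(1)] pr_nth) simp_all
  ultimately show ?thesis using t(3) by blast
qed

text \<open>Allows the exceptional finite classes to be disregarded: infinite fibres of the glued
  labelling have even labels and thus come from \<open>c\<close>, and the points \<open>e i\<close>
  only need a shift past the table.\<close>

lemma infinite_filler_PrCat:
  assumes E: "equiv UNIV E" and fin: "finite \<D>" "\<And>X. X \<in> \<D> \<Longrightarrow> X \<in> UNIV // E \<and> finite X"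
    and l: "bij_betw l (UNIV // E - \<D>) (range c)"
    and size: "\<And>X. X \<in> UNIV // E - \<D> \<Longrightarrow> X \<approx> c -` {l X}"
    and c: "primrec_fun c" and inf: "infinite (c -` {0 :: nat})"
    and avoid: "\<And>j. infinite (c -` {j}) \<Longrightarrow> \<exists>e. primrec_fun e \<and> inj e \<and> (\<forall>i. c (e i) \<noteq> j)"
    and d: "d \<in> PrCat E" "g \<in> d" and f: "Delta01_fun_in no_oracle f"
  shows "f \<le>\<^sub>P\<^sub>R g"
proof -
  obtain N w where iso: "isomorphic (fibre_rel (glue N w c)) E"
    using isomorphic_glue[OF E fin l size] by blast
  show ?thesis
  proof (rule infinite_filler_lower_bound[OF d f primrec_fun_glue[OF c] iso])
    show "infinite (glue N w c -` {0})"
      using glue_vimage_even[of N w c 0] inf by (simp add: finite_image_iff inj_on_def)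
  next
    fix j
    assume j: "infinite (glue N w c -` {j})"
    have "even j"
    proof (rule ccontr)
      assume "odd j"
      then obtain i where "j = 2 * i + 1" by (rule oddE)
      then show False using j glue_vimage_odd[of N w c i] by simp
    qed
    then obtain i where i: "j = 2 * i" by blast
    then have "infinite (c -` {i})"
      using j by (auto simp: glue_vimage_even)
    then obtain e where e: "primrec_fun e" "inj e" "\<And>n. c (e n) \<noteq> i"
      using avoid by blast
    have "primrec_fun (\<lambda>n. e n + N)"
      unfolding primrec_fun_iff by (intro pr_add pr_const pr_primrec_fun[OF e(1)] pr_nth) simp
    moreover have "inj (\<lambda>n. e n + N)" using e(2) by (auto simp: inj_def)
    moreover have "glue N w c (e n + N) \<noteq> j" for n using e(3) i by (simp add: glue_def)
    ultimately show "\<exists>e. primrec_fun e \<and> inj e \<and> (\<forall>n. glue N w c (e n) \<noteq> j)" by blast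
  qed
qed

text \<open>The point \<open>p i\<close> is pulled back by \<open>inv G\<close>. The preimage of its
  late classmate lies at most \<open>K\<close> further on, so a sum of \<open>G\<close> up to that
  position bounds \<open>t i\<close>.\<close>

lemma bounded_classes_lower_bound:
  assumes d: "d \<in> PrCat E" "g \<in> d"
    and c: "primrec_fun c" "isomorphic (fibre_rel c) E"
    and s: "primrec_fun s" "isomorphic (fibre_rel s) E"
    and near: "\<And>x y. c x = c y \<Longrightarrow> y \<le> x + K"
    and p: "primrec_fun p" and far: "\<And>i. \<exists>x. s x = s (p i) \<and> t i \<le> x"
  shows "\<exists>h. h \<le>\<^sub>P\<^sub>R g \<and> (\<forall>i. t i \<le> h i)"
proof -
  obtain G where G: "isomorphism (fibre_rel c) (fibre_rel s) G" "G \<le>\<^sub>P\<^sub>R g" "inv G \<le>\<^sub>P\<^sub>R g"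
    using PrCat_isomorphism[OF d punctual_fibre_rel[OF c(1)] c(2) punctual_fibre_rel[OF s(1)] s(2)] by blast
  have "bij G" and G_iff: "\<And>x y. c x = c y \<longleftrightarrow> s (G x) = s (G y)"
    using G(1) by (auto simp: isomorphism_def fibre_rel_def)
  let ?h = "\<lambda>i. \<Sum>y<Suc (inv G (p i) + K). G y"
  have "t i \<le> ?h i" for i
  proof -
    obtain x where x: "s x = s (p i)" "t i \<le> x" using far by blast
    have G_inv: "G (inv G y) = y" for y
      using \<open>bij G\<close> by (simp add: bij_is_surj surj_f_inv_f)
    then have "inv G x < Suc (inv G (p i) + K)"
      using near[of "inv G (p i)" "inv G x"] x(1) G_iff by (simp add: less_Suc_eq_le)
    then have "G (inv G x) \<le> ?h i" by (intro member_le_sum) auto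
    then show ?thesis using x(2) G_inv by simp
  qed
  moreover have "?h \<le>\<^sub>P\<^sub>R g"
    unfolding PR_le_iff
    by (intro pr_sum pr_Suc pr_add pr_const pr_PR_le[OF G(2)] pr_PR_le[OF G(3)] pr_primrec_fun[OF p]
        pr_nth) simp_all
  ultimately show ?thesis by blast
qed

lemma vimage_div:
  assumes "0 < (k :: nat)"
  shows "{x. x div k = l} = {l * k..<l * k + k}"
proof (intro set_eqI iffI)
  fix x assume "x \<in> {x. x div k = l}"
  then show "x \<in> {l * k..<l * k + k}"
    using div_mult_mod_eq[of x k] mod_less_divisor[OF assms, of x] by (auto simp del: div_mult_mod_eq)
qed (auto intro: div_nat_eqI simp: mult.commute)

text \<open>
  The slow copy consists of first representatives of all classes, which fill the time
  while the remaining \<open>k - 1\<close> members, at the points of \<open>range r\<close>, are late.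
\<close>

lemma equal_classes_PrCat:
  assumes E: "equiv UNIV E" and fin: "finite \<D>" "\<And>X. X \<in> \<D> \<Longrightarrow> X \<in> UNIV // E \<and> finite X"
    and K: "infinite (UNIV // E)" and k: "1 < k"
    and size: "\<And>X. X \<in> UNIV // E - \<D> \<Longrightarrow> finite X \<and> card X = k"
    and d: "d \<in> PrCat E" "g \<in> d" and f: "Delta01_fun_in no_oracle f"
  shows "f \<le>\<^sub>P\<^sub>R g"
proof -
  have "countable (UNIV // E - \<D>)"
    by (simp add: quotient_def)
  moreover have "infinite (UNIV // E - \<D>)" using K fin(1) by simp
  ultimately obtain l where l: "bij_betw l (UNIV // E - \<D>) (UNIV :: nat set)"
    using to_nat_on_infinite by blast
  have glue: "\<exists>N w. isomorphic (fibre_rel (glue N w c)) E"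
    if "\<And>j. finite (c -` {j}) \<and> card (c -` {j}) = k" for c
  proof (rule isomorphic_glue[OF E fin])
    have "j \<in> range c" for j
    proof -
      have "c -` {j} \<noteq> {}" using that[of j] k by auto
      then show ?thesis by auto
    qed
    then have "range c = UNIV" by blast
    then show "bij_betw l (UNIV // E - \<D>) (range c)" using l by simp
    show "X \<approx> c -` {l X}" if "X \<in> UNIV // E - \<D>" for X
      using size[OF that] \<open>\<And>j. finite (c -` {j}) \<and> card (c -` {j}) = k\<close> eqpoll_iff_card by metis
  qed
  obtain t where t: "mono t"
    "primrec_in no_oracle 2 (\<lambda>xs. of_bool (t (xs ! 0) = xs ! 1))"
    "\<And>g h. h \<le>\<^sub>P\<^sub>R g \<Longrightarrow> (\<And>n. t n \<le> h n) \<Longrightarrow> f \<le>\<^sub>P\<^sub>R g"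
    using Delta01_time_function[OF f] by blast
  \<comment> \<open>Late points are odd, so every even number is a filler and at least
    \<open>i\<close> fillers occur below \<open>2 * i\<close>.\<close>
  define r where "r n = Suc (2 * prod_encode (n, t n))" for n
  have r_inj: "inj r" by (auto simp: inj_def r_def inj_eq[OF inj_prod_encode])
  have range_r: "x \<in> range r \<longleftrightarrow> x mod 2 = 1 \<and>
      t (fst (prod_decode (x div 2))) = snd (prod_decode (x div 2))" for x
  proof
    assume *: "x mod 2 = 1 \<and> t (fst (prod_decode (x div 2))) = snd (prod_decode (x div 2))"
    then have "x = Suc (2 * (x div 2))" by presburger
    with * have "x = r (fst (prod_decode (x div 2)))"
      unfolding r_def by simp
    then show "x \<in> range r" by blast
  qed (auto simp: r_def)
  \<comment> \<open>A filler is labelled by the number of earlier fillers, so each label gets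
    exactly one; \<open>s\<close> deals out the late points in blocks of \<open>k - 1\<close>, which
    completes every class to \<open>k\<close> members.\<close>
  define cnt where "cnt x = (\<Sum>y<x. of_bool (y \<notin> range r) :: nat)" for x
  define s where "s x = (if x \<in> range r then fst (prod_decode (x div 2)) div (k - 1) else cnt x)" for x
  have pr_range: "primrec_in no_oracle n (\<lambda>xs. of_bool (F xs \<in> range r))"
    if "primrec_in no_oracle n F" for n F
    unfolding range_r
    by (intro pr_conj pr_eq pr_graph[OF t(2)] pr_fst_decode pr_snd_decode pr_div pr_mod pr_const that)
  have s_prim: "primrec_fun s"
    unfolding primrec_fun_iff s_def cnt_def
    by (intro pr_If pr_range pr_div pr_fst_decode pr_sum pr_not pr_nth) simp_all
  have cnt_Suc: "cnt (Suc x) = cnt x + of_bool (x \<notin> range r)" for x by (simp add: cnt_def)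
  have cnt_mono: "cnt x \<le> cnt y" if "x \<le> y" for x y
    using lift_Suc_mono_le[of cnt] that cnt_Suc by simp
  have cnt_less: "cnt x < cnt y" if "x \<notin> range r" "x < y" for x y
    using cnt_mono[of "Suc x" y] cnt_Suc[of x] that by simp
  have cnt_even: "i \<le> cnt (2 * i)" for i
  proof (induction i)
    case (Suc i)
    have "2 * i \<notin> range r" by (simp add: range_r)
    then show ?case using Suc cnt_less[of "2 * i" "2 * Suc i"] by simp
  qed simp
  have first: "\<exists>x. x \<notin> range r \<and> cnt x = j" for j
  proof -
    \<comment> \<open>The first point with which the count exceeds \<open>j\<close> is the filler
      labelled \<open>j\<close>.\<close>
    define x where "x = (LEAST x. j < cnt (Suc x))"
    have "j < cnt (Suc (2 * Suc j))"
      using cnt_even[of "Suc j"] cnt_mono[of "2 * Suc j" "Suc (2 * Suc j)"] by simp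
    then have x: "j < cnt (Suc x)" unfolding x_def by (rule LeastI)
    have "cnt x \<le> j"
    proof (cases x)
      case (Suc y)
      then have "\<not> j < cnt (Suc y)" using not_less_Least[of y "\<lambda>x. j < cnt (Suc x)"] x_def by simp
      then show ?thesis using Suc by simp
    qed (simp add: cnt_def)
    then have "x \<notin> range r \<and> cnt x = j" using x cnt_Suc[of x] by (cases "x \<in> range r") auto
    then show ?thesis ..
  qed
  have s_r: "s (r n) = n div (k - 1)" for n by (simp add: s_def r_def)
  have s_size: "finite (s -` {j}) \<and> card (s -` {j}) = k" for j
  proof -
    obtain x where x: "x \<notin> range r" "cnt x = j" using first by blast
    have x_unique: "y = x" if y: "y \<notin> range r" "cnt y = j" for y
    proof (rule ccontr)
      assume "y \<noteq> x"
      then have "x < y \<or> y < x" by linarith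
      then show False using cnt_less[OF x(1)] cnt_less[OF y(1)] x(2) y(2) by (metis less_irrefl)
    qed
    let ?A = "{j * (k - 1)..<j * (k - 1) + (k - 1)}"
    have A: "n \<in> ?A \<longleftrightarrow> n div (k - 1) = j" for n
    proof -
      have "{x. x div (k - 1) = j} = ?A" using k by (intro vimage_div) simp
      then have "n \<in> ?A \<longleftrightarrow> n \<in> {x. x div (k - 1) = j}" by (simp only:)
      then show ?thesis by (simp only: mem_Collect_eq)
    qed
    have "s -` {j} = insert x (r ` ?A)"
    proof (intro set_eqI iffI)
      fix y assume y: "y \<in> s -` {j}"
      show "y \<in> insert x (r ` ?A)"
      proof (cases "y \<in> range r")
        case True
        then obtain n where n: "y = r n" by (rule rangeE)
        then have "n div (k - 1) = j" using y s_r by simp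
        then have "n \<in> ?A" by (simp only: A)
        then show ?thesis unfolding n by (intro insertI2 imageI)
      next
        case False
        then have "cnt y = j" using y by (simp add: s_def)
        then show ?thesis using x_unique[OF False] by simp
      qed
    next
      fix y assume "y \<in> insert x (r ` ?A)"
      then consider "y = x" | n where "n \<in> ?A" "y = r n" by (elim insertE imageE)
      then show "y \<in> s -` {j}"
      proof cases
        case 1
        then show ?thesis using x by (simp add: s_def)
      next
        case 2
        from 2(1) have "n div (k - 1) = j" by (simp only: A)
        then show ?thesis using 2(2) s_r by simp
      qed
    qed
    moreover have "card (r ` ?A) = k - 1" using r_inj by (simp add: card_image inj_on_subset)
    moreover have "x \<notin> r ` ?A" using x(1) by (metis rangeI imageE)
    moreover have "finite (r ` ?A)" by simp
    ultimately show ?thesis using k by (simp only: finite_insert card_insert_disjoint) simp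
  qed
  have c_size: "finite ((\<lambda>x. x div k) -` {j}) \<and> card ((\<lambda>x. x div k) -` {j}) = k" for j
    using vimage_div[of k j] k by (simp add: vimage_def)
  obtain N w where fast: "isomorphic (fibre_rel (glue N w (\<lambda>x. x div k))) E"
    using glue[of "\<lambda>x. x div k", OF c_size] by blast
  obtain M v where slow: "isomorphic (fibre_rel (glue M v s)) E"
    using glue[of s, OF s_size] by blast
  have "\<exists>h. h \<le>\<^sub>P\<^sub>R g \<and> (\<forall>i. t i \<le> h i)"
  proof (rule bounded_classes_lower_bound[OF d _ fast _ slow])
    show "primrec_fun (glue N w (\<lambda>x. x div k))"
      by (intro primrec_fun_glue) (simp add: primrec_fun_iff, intro pr_div pr_nth, simp)
    show "primrec_fun (glue M v s)" by (rule primrec_fun_glue[OF s_prim])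
    \<comment> \<open>The filler \<open>2 * i\<close>, shifted past the table of \<open>M\<close>
      exceptional points.\<close>
    show "primrec_fun (\<lambda>i. 2 * i + M)"
      unfolding primrec_fun_iff by (intro pr_add pr_mult pr_const pr_nth) simp
    fix x y
    assume *: "glue N w (\<lambda>x. x div k) x = glue N w (\<lambda>x. x div k) y"
    \<comment> \<open>\<open>N\<close> accounts for \<open>y\<close> in the table, \<open>k\<close>
      for \<open>y\<close> in the same block of length \<open>k\<close> as \<open>x\<close>.\<close>
    show "y \<le> x + (N + k)"
    proof (cases "y < N")
      case False
      then have "glue N w (\<lambda>x. x div k) y = 2 * ((y - N) div k)" by (simp add: glue_def)
      with * have "x \<in> glue N w (\<lambda>x. x div k) -` {2 * ((y - N) div k)}" by simp
      then obtain z where z: "x = z + N" "z div k = (y - N) div k"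
        unfolding glue_vimage_even by auto
      have "y - N \<le> z + k"
        using div_mult_mod_eq[of "y - N" k, folded z(2)] div_mult_mod_eq[of z k]
          mod_less_divisor[of k "y - N"] k by linarith
      then show ?thesis using z(1) by simp
    qed simp
  next
    fix i
    \<comment> \<open>\<open>?n\<close> indexes the first late member of the class of the filler
      \<open>2 * i\<close>. Since \<open>1 < k\<close>, it satisfies
      \<open>i \<le> ?l \<le> ?n\<close>, so monotonicity places that member at or beyond
      \<open>t i\<close>.\<close>
    let ?l = "cnt (2 * i)"
    let ?n = "?l * (k - 1)"
    have "?l * 1 \<le> ?n" using k by (intro mult_le_mono2) simp
    then have "?l \<le> ?n" by (simp only: mult_1_right)
    then have "i \<le> ?n" using cnt_even[of i] by (rule le_trans[rotated])
    then have "t i \<le> t ?n" using t(1) monoD by blast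
    also have "\<dots> \<le> r ?n + M" using le_prod_encode_2[of "t ?n" ?n] by (simp add: r_def)
    finally have "t i \<le> r ?n + M" .
    moreover have "s (2 * i) = ?l" by (simp add: s_def range_r)
    then have "glue M v s (r ?n + M) = glue M v s (2 * i + M)"
      using k by (simp add: glue_def s_r)
    ultimately show "\<exists>x. glue M v s x = glue M v s (2 * i + M) \<and> t i \<le> x" by blast
  qed
  then show ?thesis using t(3) by blast
qed

text \<open>Outside \<open>D\<close> the relation is total or equality, both invariant under every
  permutation, so each permutation fixing \<open>D\<close> pointwise is an automorphism.\<close>

lemma punctually_categorical_uniform_outside:
  assumes "finite D" and closed: "\<And>x y. (x, y) \<in> E \<Longrightarrow> x \<in> D \<longleftrightarrow> y \<in> D"
    and outside: "(\<forall>x y. x \<notin> D \<longrightarrow> y \<notin> D \<longrightarrow> (x, y) \<in> E) \<or>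
      (\<forall>x y. x \<notin> D \<longrightarrow> y \<notin> D \<longrightarrow> ((x, y) \<in> E \<longleftrightarrow> x = y))"
  shows "punctually_categorical E"
proof (rule punctually_categorical_finite_support[OF assms(1)])
  fix \<pi> :: "nat \<Rightarrow> nat" and x y
  assume bij: "bij \<pi>" and fix_D: "\<And>x. x \<in> D \<Longrightarrow> \<pi> x = x"
  have inj: "\<pi> x = \<pi> y \<longleftrightarrow> x = y" for x y
    using bij by (simp add: bij_def inj_eq)
  have \<pi>_D: "\<pi> x \<in> D \<longleftrightarrow> x \<in> D" for x
    using fix_D[of x] fix_D[of "\<pi> x"] inj[of "\<pi> x" x] by auto
  consider "x \<in> D" "y \<in> D" | "x \<in> D \<longleftrightarrow> y \<notin> D" | "x \<notin> D" "y \<notin> D" by blast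
  then show "(x, y) \<in> E \<longleftrightarrow> (\<pi> x, \<pi> y) \<in> E"
  proof cases
    case 1
    then show ?thesis using fix_D by simp
  next
    case 2
    then show ?thesis using closed \<pi>_D by metis
  next
    case 3
    then have "\<pi> x \<notin> D" "\<pi> y \<notin> D" using \<pi>_D by auto
    with 3 show ?thesis using outside inj by metis
  qed
qed

lemma Union_classes_closed:
  assumes E: "equiv UNIV E" and \<D>: "\<D> \<subseteq> UNIV // E" and xy: "(x, y) \<in> E"
  shows "x \<in> \<Union>\<D> \<longleftrightarrow> y \<in> \<Union>\<D>"
proof -
  have "y \<in> \<Union>\<D>" if "x \<in> \<Union>\<D>" "(x, y) \<in> E" for x y
    using that \<D> quotient_mem_iff[OF E] by blast
  moreover have "(y, x) \<in> E" using E xy by (meson equivE symD)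
  ultimately show ?thesis using xy by blast
qed

lemma primrec_fun_arith:
  shows "primrec_fun (\<lambda>x. x * a + b)" and "primrec_fun (\<lambda>x. x mod a)"
    and "primrec_fun (\<lambda>x. fst (prod_decode x))" and "primrec_fun (\<lambda>x. prod_encode (a, x))"
  unfolding primrec_fun_iff
  by (intro pr_add pr_mult pr_mod pr_fst_decode pr_prod_encode pr_const pr_nth; simp)+

section \<open>Case distinction by class sizes\<close>

context
  fixes E :: "nat rel"
  assumes E: "equiv UNIV E" and not_cat: "\<not> punctually_categorical E"
begin

text \<open>Provides a second infinite class, from which points avoiding the filler class can be
  taken.\<close>

lemma no_single_class_outside:
  assumes "finite \<D>" and "\<And>X. X \<in> \<D> \<Longrightarrow> X \<in> UNIV // E \<and> finite X"
    and "UNIV // E - \<D> \<subseteq> {X}"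
  shows False
proof -
  have "punctually_categorical E"
  proof (rule punctually_categorical_uniform_outside[where D = "\<Union>\<D>"])
    show "finite (\<Union>\<D>)" using assms by blast
    show "x \<in> \<Union>\<D> \<longleftrightarrow> y \<in> \<Union>\<D>" if "(x, y) \<in> E" for x y
      using Union_classes_closed[OF E _ that] assms(2) by blast
    have "E `` {x} = X" if "x \<notin> \<Union>\<D>" for x
    proof -
      have "x \<in> E `` {x}" using equiv_class_self[OF E] by blast
      then have "E `` {x} \<in> UNIV // E - \<D>" using that by (blast intro: quotientI)
      then show ?thesis using assms(3) by blast
    qed
    then have "(x, y) \<in> E" if "x \<notin> \<Union>\<D>" "y \<notin> \<Union>\<D>" for x y
      using that eq_equiv_class_iff[OF E, of x y] by simp
    then show "(\<forall>x y. x \<notin> \<Union>\<D> \<longrightarrow> y \<notin> \<Union>\<D> \<longrightarrow> (x, y) \<in> E) \<or>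
        (\<forall>x y. x \<notin> \<Union>\<D> \<longrightarrow> y \<notin> \<Union>\<D> \<longrightarrow> ((x, y) \<in> E \<longleftrightarrow> x = y))"
      by blast
  qed
  then show False using not_cat by simp
qed

text \<open>Provides \<open>k \<noteq> 1\<close> when all classes are finite: singletons would leave
  no further members to be delayed.\<close>

lemma no_cofinite_singletons:
  assumes "finite \<D>" and "\<And>X. X \<in> \<D> \<Longrightarrow> X \<in> UNIV // E \<and> finite X"
    and single: "\<And>X. X \<in> UNIV // E - \<D> \<Longrightarrow> card X = 1"
  shows False
proof -
  have "punctually_categorical E"
  proof (rule punctually_categorical_uniform_outside[where D = "\<Union>\<D>"])
    show "finite (\<Union>\<D>)" using assms(1,2) by blast
    show "x \<in> \<Union>\<D> \<longleftrightarrow> y \<in> \<Union>\<D>" if "(x, y) \<in> E" for x y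
      using Union_classes_closed[OF E _ that] assms(2) by blast
    have "(x, y) \<in> E \<longleftrightarrow> x = y" if "x \<notin> \<Union>\<D>" for x y
    proof -
      have x: "x \<in> E `` {x}" using equiv_class_self[OF E] by blast
      then have "E `` {x} \<in> UNIV // E - \<D>" using that by (blast intro: quotientI)
      then obtain z where "E `` {x} = {z}" using single card_1_singletonE by metis
      then have "E `` {x} = {x}" using x by simp
      then show ?thesis by (metis Image_singleton_iff singleton_iff)
    qed
    then show "(\<forall>x y. x \<notin> \<Union>\<D> \<longrightarrow> y \<notin> \<Union>\<D> \<longrightarrow> (x, y) \<in> E) \<or>
        (\<forall>x y. x \<notin> \<Union>\<D> \<longrightarrow> y \<notin> \<Union>\<D> \<longrightarrow> ((x, y) \<in> E \<longleftrightarrow> x = y))"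
      by blast
  qed
  then show False using not_cat by simp
qed

lemma countable_classes: "countable (UNIV // E)"
  by (simp add: quotient_def)

text \<open>Outside \<open>\<D>\<close> all classes are infinite, so a labelling only needs infinite
  fibres in the right number: residues modulo \<open>M\<close> for \<open>M\<close> classes, first
  components of pairs for infinitely many.\<close>

lemma finitely_many_finite_classes_PrCat:
  assumes fin: "finite {X \<in> UNIV // E. finite X}"
    and d: "d \<in> PrCat E" "g \<in> d" and f: "Delta01_fun_in no_oracle f"
  shows "f \<le>\<^sub>P\<^sub>R g"
proof -
  define \<D> where "\<D> = {X \<in> UNIV // E. finite X}"
  have \<D>: "finite \<D>" "\<And>X. X \<in> \<D> \<Longrightarrow> X \<in> UNIV // E \<and> finite X"
    using fin by (auto simp: \<D>_def)
  have inf: "infinite X" if "X \<in> UNIV // E - \<D>" for X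
    using that by (simp add: \<D>_def)
  show ?thesis
  proof (cases "finite (UNIV // E - \<D>)")
    case True
    define M where "M = card (UNIV // E - \<D>)"
    obtain l where l: "bij_betw l (UNIV // E - \<D>) {0..<M}"
      using ex_bij_betw_finite_nat[OF True] by (auto simp: M_def)
    have M: "1 < M"
    proof (rule ccontr)
      assume "\<not> 1 < M"
      then have "card (UNIV // E - \<D>) \<le> Suc 0" by (simp add: M_def)
      then have eq: "\<forall>X\<in>UNIV // E - \<D>. \<forall>Y\<in>UNIV // E - \<D>. X = Y"
        by (simp only: card_le_Suc0_iff_eq[OF True])
      have "UNIV // E - \<D> \<subseteq> {SOME X. X \<in> UNIV // E - \<D>}"
      proof
        fix X assume X: "X \<in> UNIV // E - \<D>"
        then have "(SOME X. X \<in> UNIV // E - \<D>) \<in> UNIV // E - \<D>" by (rule someI)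
        with eq X show "X \<in> {SOME X. X \<in> UNIV // E - \<D>}" by blast
      qed
      then show False using no_single_class_outside \<D> by metis
    qed
    have mod_inf: "infinite ((\<lambda>x. x mod M) -` {j})" if "j < M" for j
    proof -
      have "range (\<lambda>i. i * M + j) \<subseteq> (\<lambda>x. x mod M) -` {j}" using that by auto
      moreover have "inj (\<lambda>i. i * M + j)" using M by (auto simp: inj_def)
      ultimately show ?thesis
        by (meson finite_subset infinite_UNIV_nat finite_imageD)
    qed
    have range: "range (\<lambda>x. x mod M) = {0..<M}"
    proof (intro set_eqI iffI)
      fix j assume "j \<in> {0..<M}"
      then show "j \<in> range (\<lambda>x. x mod M)" by (intro image_eqI[of _ _ j]) auto
    qed (use M in auto)
    show ?thesis
    proof (rule infinite_filler_PrCat[OF E \<D> _ _ primrec_fun_arith(2) _ _ d f])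
      show "bij_betw l (UNIV // E - \<D>) (range (\<lambda>x. x mod M))"
        unfolding range by (rule l)
      show "X \<approx> (\<lambda>x. x mod M) -` {l X}" if "X \<in> UNIV // E - \<D>" for X
        using bij_betwE[OF l] that by (intro infinite_nat_sets_eqpoll inf mod_inf) auto
      show "infinite ((\<lambda>x. x mod M) -` {0})" using mod_inf M by simp
      fix j :: nat
      define b where "b = (if j = 0 then 1 else 0 :: nat)"
      have b: "b < M" "b \<noteq> j" using M by (auto simp: b_def)
      have "(x * M + b) mod M \<noteq> j" for x using b by simp
      moreover have "inj (\<lambda>x. x * M + b)" using M by (auto simp: inj_def)
      ultimately show "\<exists>e. primrec_fun e \<and> inj e \<and> (\<forall>i. e i mod M \<noteq> j)"
        using primrec_fun_arith(1)[of M b] by blast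
    qed
  next
    case False
    have "countable (UNIV // E - \<D>)" using countable_classes by simp
    then obtain l where l: "bij_betw l (UNIV // E - \<D>) (UNIV :: nat set)"
      using to_nat_on_infinite False by blast
    let ?c = "\<lambda>x. fst (prod_decode x)"
    have c: "?c (prod_encode (a, b)) = a" for a b by simp
    have e_inj: "inj (\<lambda>x. prod_encode (a, x))" for a
      by (auto simp: inj_def inj_eq[OF inj_prod_encode])
    have c_inf: "infinite (?c -` {j})" for j
    proof -
      have "range (\<lambda>x. prod_encode (j, x)) \<subseteq> ?c -` {j}" by auto
      then show ?thesis
        using e_inj[of j] by (meson finite_subset infinite_UNIV_nat finite_imageD)
    qed
    have "j \<in> range ?c" for j using c[of j 0] by (metis rangeI)
    then have range: "range ?c = UNIV" by blast
    show ?thesis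
    proof (rule infinite_filler_PrCat[OF E \<D> _ _ primrec_fun_arith(3) c_inf _ d f])
      show "bij_betw l (UNIV // E - \<D>) (range ?c)" unfolding range by (rule l)
      show "X \<approx> ?c -` {l X}" if "X \<in> UNIV // E - \<D>" for X
        using that by (intro infinite_nat_sets_eqpoll inf c_inf)
      fix j :: nat
      have "?c (prod_encode (Suc j, i)) \<noteq> j" for i by simp
      then show "\<exists>e. primrec_fun e \<and> inj e \<and> (\<forall>i. ?c (e i) \<noteq> j)"
        using primrec_fun_arith(4)[of "Suc j"] e_inj[of "Suc j"] by blast
    qed
  qed
qed

lemma cofinitely_many_equal_classes_PrCat:
  assumes fin: "finite {X \<in> UNIV // E. \<not> (finite X \<and> card X = k)}" and Q: "infinite (UNIV // E)"
    and d: "d \<in> PrCat E" "g \<in> d" and f: "Delta01_fun_in no_oracle f"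
  shows "f \<le>\<^sub>P\<^sub>R g"
proof -
  define Z where "Z = {X \<in> UNIV // E. \<not> (finite X \<and> card X = k)}"
  \<comment> \<open>The exceptional classes are split by finiteness because \<open>glue\<close> can
    tabulate only the finite ones.\<close>
  define I where "I = {X \<in> Z. infinite X}"
  define \<D> where "\<D> = {X \<in> Z. finite X}"
  have "finite Z" using fin by (simp add: Z_def)
  then have I: "finite I" and \<D>_fin: "finite \<D>" by (simp_all add: I_def \<D>_def)
  have \<D>_mem: "X \<in> UNIV // E \<and> finite X" if "X \<in> \<D>" for X
    using that by (simp add: \<D>_def Z_def)
  note \<D> = \<D>_fin \<D>_mem
  have Z: "Z \<subseteq> UNIV // E" by (auto simp: Z_def)
  have K: "finite X \<and> card X = k" if "X \<in> UNIV // E - Z" for X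
    using that by (simp add: Z_def)
  have K_inf: "infinite (UNIV // E - Z)" using Q \<open>finite Z\<close> by simp
  then obtain X where X: "X \<in> UNIV // E - Z" by (metis equals0I finite.emptyI)
  have "X \<noteq> {}" using X E in_quotient_imp_non_empty by blast
  then have k: "0 < k" using K[OF X] by auto
  show ?thesis
  proof (cases "I = {}")
    case True
    have ZD: "Z = \<D>" using True by (auto simp: I_def \<D>_def)
    have "k \<noteq> 1"
      using no_cofinite_singletons[OF \<D>] K ZD by blast
    then show ?thesis
      using equal_classes_PrCat[OF E \<D> Q _ _ d f, of k] K ZD k by simp
  next
    case False
    define m where "m = card I"
    have m: "0 < m" using False I by (simp add: m_def card_gt_0_iff)
    obtain l1 where l1: "bij_betw l1 I {0..<m}"
      using ex_bij_betw_finite_nat[OF I] by (auto simp: m_def)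
    have "countable (UNIV // E - Z)" using countable_classes by simp
    then obtain l2 where l2: "bij_betw l2 (UNIV // E - Z) (UNIV :: nat set)"
      using to_nat_on_infinite K_inf by blast
    define l where "l X = (if X \<in> I then l1 X else m + l2 X)" for X
    \<comment> \<open>Even points are dealt cyclically to the \<open>m\<close> infinite classes; odd
      points fill classes of size \<open>k\<close> one after another, with labels from
      \<open>m\<close> on. Thus the odd points avoid every infinite class.\<close>
    define c where "c x = (if x mod 2 = 0 then x div 2 mod m else m + x div 2 div k)" for x
    have c_even: "c (2 * x) = x mod m" and c_odd: "c (2 * x + 1) = m + x div k" for x
      by (simp_all add: c_def)
    have c_ge: "c -` {m + j} = (\<lambda>x. 2 * x + 1) ` {x. x div k = j}" for j
    proof (intro set_eqI iffI)
      fix x assume x: "x \<in> c -` {m + j}"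
      have "x mod 2 \<noteq> 0"
      proof
        assume "x mod 2 = 0"
        then have "x div 2 mod m = m + j" using x by (simp add: c_def)
        moreover have "x div 2 mod m < m" using m by simp
        ultimately show False by simp
      qed
      then have "x = 2 * (x div 2) + 1" by presburger
      moreover have "x div 2 div k = j" using x \<open>x mod 2 \<noteq> 0\<close> by (simp add: c_def)
      ultimately show "x \<in> (\<lambda>x. 2 * x + 1) ` {x. x div k = j}" by blast
    next
      fix x assume "x \<in> (\<lambda>x. 2 * x + 1) ` {x. x div k = j}"
      then obtain y where "x = 2 * y + 1" "y div k = j" by blast
      then show "x \<in> c -` {m + j}" using c_odd[of y] by simp
    qed
    have less_inf: "infinite (c -` {j})" if j: "j < m" for j
    proof -
      have "c (2 * (i * m + j)) = j" for i unfolding c_even using j by simp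
      then have "range (\<lambda>i. 2 * (i * m + j)) \<subseteq> c -` {j}" by blast
      moreover have "inj (\<lambda>i. 2 * (i * m + j))" using m by (auto simp: inj_def)
      ultimately show ?thesis
        by (meson finite_subset infinite_UNIV_nat finite_imageD)
    qed
    have ge_card: "finite (c -` {m + j}) \<and> card (c -` {m + j}) = k" for j
    proof -
      have "inj_on (\<lambda>x. 2 * x + 1) {j * k..<j * k + k}" by (auto simp: inj_on_def)
      then show ?thesis unfolding c_ge vimage_div[OF k] by (simp add: card_image)
    qed
    have split: "UNIV // E - \<D> = I \<union> (UNIV // E - Z)" using Z by (auto simp: I_def \<D>_def)
    have I_Z: "X \<notin> I" if "X \<in> UNIV // E - Z" for X using that by (auto simp: I_def)
    have "j \<in> range c" for j
    proof (cases "j < m")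
      case True
      then show ?thesis using c_even[of j] by (metis mod_less rangeI)
    next
      case False
      then have "c (2 * ((j - m) * k) + 1) = j" using c_odd[of "(j - m) * k"] k by simp
      then show ?thesis by (metis rangeI)
    qed
    then have range: "range c = {0..<m} \<union> {m..}" by (auto simp: not_less)
    have "bij_betw l I {0..<m}"
      using l1 by (subst bij_betw_cong[of _ _ l1]) (auto simp: l_def)
    moreover have "bij_betw l (UNIV // E - Z) {m..}"
    proof (rule bij_betw_imageI)
      show "inj_on l (UNIV // E - Z)"
        using bij_betw_imp_inj_on[OF l2] I_Z by (auto simp: inj_on_def l_def)
      have "l ` (UNIV // E - Z) = (\<lambda>j. m + j) ` (l2 ` (UNIV // E - Z))"
        unfolding image_image using I_Z by (intro image_cong) (auto simp: l_def)
      also have "\<dots> = range (\<lambda>j. m + j)" using bij_betw_imp_surj_on[OF l2] by simp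
      also have "\<dots> = {m..}"
        using le_Suc_ex by (auto simp: image_iff)
      finally show "l ` (UNIV // E - Z) = {m..}" .
    qed
    ultimately have l: "bij_betw l (UNIV // E - \<D>) (range c)"
      unfolding split range by (rule bij_betw_combine) auto
    show ?thesis
    proof (rule infinite_filler_PrCat[OF E \<D> l _ _ less_inf[OF m] _ d f])
      fix X assume X: "X \<in> UNIV // E - \<D>"
      show "X \<approx> c -` {l X}"
      proof (cases "X \<in> I")
        case True
        then have "l X < m" using bij_betwE[OF l1] by (auto simp: l_def)
        then show ?thesis
          using True less_inf by (intro infinite_nat_sets_eqpoll) (auto simp: I_def)
      next
        case False
        then have "X \<in> UNIV // E - Z" using X split by blast
        then show ?thesis
          using False K[of X] ge_card[of "l2 X"] by (simp add: l_def eqpoll_iff_card)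
      qed
    next
      show "primrec_fun c"
        unfolding primrec_fun_iff c_def
        by (intro pr_If pr_eq pr_mod pr_div pr_add pr_const pr_nth; simp)
    next
      fix j assume j: "infinite (c -` {j})"
      have "j < m"
      proof (rule ccontr)
        assume "\<not> j < m"
        then obtain i where "j = m + i" using le_Suc_ex not_less by blast
        then show False using j ge_card by simp
      qed
      then have "c (i * 2 + 1) \<noteq> j" for i
        using c_odd[of i] by (simp add: mult.commute)
      moreover have "inj (\<lambda>i. i * 2 + 1 :: nat)" by (auto simp: inj_def)
      ultimately show "\<exists>e. primrec_fun e \<and> inj e \<and> (\<forall>i. c (e i) \<noteq> j)"
        using primrec_fun_arith(1)[of 2 1] by blast
    qed
  qed
qed

lemma PrCat_subset_Cone:
  assumes "rel_Delta01_categorical E"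
  shows "PrCat E \<subseteq> Cone_Delta01"
proof
  fix d assume d: "d \<in> PrCat E"
  then have deg: "d \<in> PR_degrees" by (simp add: PrCat_def)
  then obtain g where g: "g \<in> d" by (rule PR_degree_nonempty)
  have "f \<le>\<^sub>P\<^sub>R g" if f: "Delta01_fun_in no_oracle f" for f
  proof (cases "finite {X \<in> UNIV // E. finite X}")
    case True
    then show ?thesis using finitely_many_finite_classes_PrCat d g f by blast
  next
    case False
    then obtain k where k: "finite {X \<in> UNIV // E. \<not> (finite X \<and> card X = k)}"
      using class_sizes_if_rel_Delta01_categorical[OF E assms] by blast
    have "{X \<in> UNIV // E. finite X} \<subseteq> UNIV // E" by blast
    then have "infinite (UNIV // E)" using False finite_subset by blast
    then show ?thesis using cofinitely_many_equal_classes_PrCat[OF k _ d g f] by blast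
  qed
  then show "d \<in> Cone_Delta01"
    using deg PR_le_degree_iff[OF deg g] by (simp add: Cone_Delta01_def)
qed

end

theorem theorem2p1:
  fixes E :: "nat rel"
  assumes "equiv UNIV E"
    and "punctual E"
    and "rel_Delta01_categorical E"
    and "\<not> punctually_categorical E"
  shows "PrCat E = Cone_Delta01"
  using PrCat_subset_Cone[OF assms(1,4,3)] Cone_subset_PrCat[OF assms(3)] by (rule equalityI)

end
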